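(* Let $\delta>0$. Let $\mathcal X_0\in\mathrm{Gr}(n,k)$ satisfy $\mathrm{dist}(\mathcal X_0,\mathcal V_\alpha)\le\frac\pi4$. Then the iterates of Riemannian steepest descent with step size $\eta=\frac1\gamma$, i.e. $\mathcal X_{t+1}=\mathrm{Exp}_{\mathcal X_t}\bigl(-\tfrac1\gamma\,\mathrm{grad}f(\mathcal X_t)\bigr)$, satisfy for all $t\ge0$ $$f(\mathcal X_t)-f^*\le\Bigl(1-0.32\,c_Q\,\frac\delta\gamma\Bigr)^t(f(\mathcal X_0)-f^* ),\qquad c_Q=\frac4{\pi^2}.$$
   Context: Let $1\le k\le n-1$ and let $A\in\mathbb R^{n\times n}$ be symmetric positive semidefinite with eigenvalues $\lambda_1\ge\cdots\ge\lambda_n$ (with multiplicity) and orthonormal eigenvectors $v_1,\dots,v_n$, $Av_i=\lambda_iv_i$. Put $\delta=\lambda_k-\lambda_{k+1}$, $\gamma=2(\lambda_1-\lambda_n)$ (so $\gamma>0$ when $\delta>0$) and $\mathcal V_\alpha=\mathrm{span}(v_1,\dots,v_k)$. $\mathrm{Gr}(n,k)$ is the Grassmann manifold of $k$-dimensional subspaces of $\mathbb R^n$; a subspace $\mathcal X=\mathrm{span}(X)$ is always represented by $X\in\mathbb R^{n\times k}$ with $X^TX=I_k$. Tangent vectors at $\mathcal X$ (for a given representative $X$) are the $G\in\mathbb R^{n\times k}$ with $X^TG=0$; the Riemannian metric is $\langle G_1,G_2\rangle=\mathrm{Tr}(G_1^TG_2)$. Exponential map: $\mathrm{Exp}_{\mathcal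 X}(G)=\mathrm{span}(XV\cos(\Sigma)+U\sin(\Sigma))$, where $G=U\Sigma V^T$ is a compact SVD with $\Sigma,V\in\mathbb R^{k\times k}$. The principal angles $0\le\theta_1\le\cdots\le\theta_k\le\pi/2$ between $\mathcal X=\mathrm{span}(X)$ and $\mathcal Y=\mathrm{span}(Y)$ are such that $\cos\theta_1,\dots,\cos\theta_k$ are the singular values of $Y^TX$; the Riemannian distance is $\mathrm{dist}(\mathcal X,\mathcal Y)=\sqrt{\theta_1^2+\cdots+\theta_k^2}$. The objective is $f:\mathrm{Gr}(n,k)\to\mathbb R$, $f(\mathcal X)=-\mathrm{Tr}(X^TAX)$, with Riemannian gradient $\mathrm{grad}f(\mathcal X)=-2(I-XX^T)AX$ and global minimum $f^*=-(\lambda_1+\cdots+\lambda_k)$. *)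

theory Defs
  imports "HOL-Analysis.Analysis" "HOL-Library.Multiset"
begin

text \<open>
  Dimensions are index types: an \<open>n \<times> k\<close> real matrix has type \<^typ>\<open>real^'k^'n\<close>, with
  \<open>n = CARD('n)\<close> and \<open>k = CARD('k)\<close>. Points of the Grassmannian are subspaces of \<^typ>\<open>real^'n\<close>.
  The functions of subspaces below are evaluated on an orthonormal representative (as are tangent
  vectors, which are only defined relative to one).
\<close>

definition Gr :: "nat \<Rightarrow> (real^'n) set set" where
  "Gr k = {S. subspace S \<and> dim S = k}"

definition represents :: "real^'k^'n \<Rightarrow> (real^'n) set \<Rightarrow> bool" where
  "represents X S \<longleftrightarrow> transpose X ** X = mat 1 \<and> span (columns X) = S"

definition diag :: "real^'k \<Rightarrow> real^'k^'k" where
  "diag d = (\<chi> i j. if i = j then d $ i else 0)"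

text \<open>Compact singular value decomposition \<open>M = U \<Sigma> V\<^sup>T\<close> of an \<open>m \<times> k\<close> matrix with square
  \<open>\<Sigma>, V \<in> \<real>\<^sup>k\<^sup>\<times>\<^sup>k\<close> (zero singular values are kept); it exists whenever \<open>k \<le> m\<close>.\<close>

definition compact_svd :: "real^'k^'m \<Rightarrow> real^'k^'m \<Rightarrow> real^'k \<Rightarrow> real^'k^'k \<Rightarrow> bool" where
  "compact_svd M U \<sigma> V \<longleftrightarrow>
     transpose U ** U = mat 1 \<and> orthogonal_matrix V \<and> (\<forall>i. 0 \<le> \<sigma> $ i) \<and>
     M = U ** diag \<sigma> ** transpose V"

text \<open>In the choices below the selected object is mathematically unique.\<close>

definition singular_values :: "real^'k^'m \<Rightarrow> real multiset" where
  "singular_values M =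
     (SOME S. \<exists>U \<sigma> V. compact_svd M U \<sigma> V \<and> S = image_mset (\<lambda>i. \<sigma> $ i) (mset_set UNIV))"

definition principal_angles :: "real^'k^'n \<Rightarrow> real^'k^'n \<Rightarrow> real list" where
  "principal_angles X Y =
     (SOME \<theta>s. sorted \<theta>s \<and> set \<theta>s \<subseteq> {0..pi/2} \<and>
        mset (map cos \<theta>s) = singular_values (transpose Y ** X))"

definition grassmann_dist :: "real^'k^'n \<Rightarrow> real^'k^'n \<Rightarrow> real" where
  "grassmann_dist X Y = sqrt (\<Sum>\<theta>\<leftarrow>principal_angles X Y. \<theta>\<^sup>2)"

definition grassmann_exp :: "real^'k^'n \<Rightarrow> real^'k^'n \<Rightarrow> (real^'n) set" where
  "grassmann_exp X G =
     (SOME S. \<exists>U \<sigma> V. compact_svd G U \<sigma> V \<and>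
        S = span (columns (X ** V ** diag (\<chi> i. cos (\<sigma> $ i)) + U ** diag (\<chi> i. sin (\<sigma> $ i)))))"

definition objective :: "real^'n^'n \<Rightarrow> real^'k^'n \<Rightarrow> real" where
  "objective A X = - trace (transpose X ** A ** X)"

text \<open>The gradient for the metric \<open>\<langle>G, H\<rangle> = Tr (G\<^sup>T H)\<close>.\<close>

definition riem_grad :: "real^'n^'n \<Rightarrow> real^'k^'n \<Rightarrow> real^'k^'n" where
  "riem_grad A X = - 2 *\<^sub>R ((mat 1 - X ** transpose X) ** A ** X)"

end

theory Submission
  imports Defs
begin

text \<open>
  Write \<open>P = V V\<^sup>T\<close> for the projector onto the dominant subspace, \<open>s(X) = k - |V\<^sup>T X|\<^sup>2\<close> for the sum of
  the squared sines of the principal angles, \<open>F = f - f\<^sup>*\<close>, and \<open>Z = (I - X X\<^sup>T) A X\<close>, so that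
  \<open>grad f = - 2 Z\<close>. One elementary inequality is used twice. Along a geodesic of unit time with
  initial velocity \<open>G\<close>, a trace \<open>Tr (X\<^sup>T H X)\<close> with \<open>H\<close> symmetric falls short of its first-order expansion by at most
  \<open>(M - m) |G|\<^sup>2\<close>, where \<open>[m, M]\<close> contains the spectrum of \<open>H\<close>
  (\<open>grassmann_exp_second_order_bound\<close>). In the basis of the singular value decomposition of \<open>G\<close> this
  is a statement about rotations in orthogonal planes.

  For \<open>H = A\<close> it is the descent inequality \<open>F' \<le> F - 2 |Z|\<^sup>2 / \<gamma>\<close>. For \<open>H = P\<close> it says
  \<open>s' \<le> s - (4 / \<gamma>) B + (4 / \<gamma>\<^sup>2) |Z|\<^sup>2\<close>, where \<open>B = \<langle>P X, Z\<rangle>\<close> measures how far the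
  descent direction points towards the dominant subspace. The spectral heart of the proof
  (\<open>gap_coupling_ge_excess\<close>) is \<open>B \<ge> c F\<close>, whenever all squared cosines of the principal angles
  are at least \<open>c\<close>.

  This inequality has two consequences. Since \<open>B\<^sup>2 \<le> s |Z|\<^sup>2\<close> and \<open>\<delta> s \<le> F\<close>, the
  gradient dominates the excess, \<open>c\<^sup>2 \<delta> F \<le> |Z|\<^sup>2\<close>, and one step contracts \<open>F\<close> by
  \<open>1 - 2 c\<^sup>2 \<delta> / \<gamma>\<close>. Moreover, the descent inequality bounds the error term in the recursion for
  \<open>s\<close>, and \<open>s' + (2 / \<gamma>) F' \<le> s + (1 - 2 c) (2 / \<gamma>) F\<close>. Initially all principal angles are at
  most \<open>\<pi>/4\<close>, so \<open>c = 1/2\<close> is admissible in the first step and the potential \<open>s + (2 / \<gamma>) F\<close> drops to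
  at most \<open>s(X\<^sub>0) \<le> (\<pi>/4)\<^sup>2 < 0.64\<close>; from then on any \<open>c \<ge> 0\<close> keeps it from increasing. Hence
  \<open>s \<le> 0.64\<close> throughout. Every squared cosine is at least \<open>1 - s\<close>, so \<open>c = 0.36\<close> is admissible in
  every step, and
  \<open>2 \<cdot> 0.36\<^sup>2\<close> exceeds \<open>0.32 \<cdot> 4 / \<pi>\<^sup>2\<close>.
\<close>

(* Keeps terms of the form "transpose M *v x", and intervals starting at 1, in the shape in which
   the lemmas below state them. *)
declare transpose_matrix_vector [simp del] One_nat_def [simp del]

section \<open>The Frobenius inner product\<close>

text \<open>The inner product of \<^typ>\<open>real^'k^'n\<close> is the Frobenius one, \<open>X \<bullet> Y = Tr (X\<^sup>T Y)\<close>. All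
  traces are handled through it: matrix factors move across by transposition, and summing over
  columns reduces statements about matrices to statements about vectors.\<close>

lemma column_matrix_mult: "column j (A ** B) = A *v column j B"
  by (simp add: vec_eq_iff column_def matrix_matrix_mult_def matrix_vector_mult_def)

lemma matrix_diff_ldistrib: "A ** (B - C) = A ** B - A ** C" for A :: "real^'m^'n"
  by (simp add: matrix_matrix_mult_def vec_eq_iff algebra_simps sum_subtractf)

lemma matrix_diff_rdistrib: "(B - C) ** A = B ** A - C ** A" for A :: "real^'m^'n"
  by (simp add: matrix_matrix_mult_def vec_eq_iff algebra_simps sum_subtractf)

lemma matrix_mult_scaleR: "M ** (r *\<^sub>R N) = r *\<^sub>R (M ** N)" for M :: "real^'m^'n"
  by (simp add: matrix_matrix_mult_def vec_eq_iff sum_distrib_left mult_ac)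

lemma inner_transpose_left: "(transpose M *v x) \<bullet> y = x \<bullet> (M *v y)" for M :: "real^'k^'m"
  by (metis dot_lmul_matrix transpose_matrix_vector)

lemma inner_transpose_right: "x \<bullet> (transpose M *v y) = (M *v x) \<bullet> y" for M :: "real^'k^'m"
  by (metis inner_commute inner_transpose_left)

lemma inner_matrix_columns:
  fixes X Y :: "real^'k^'n"
  shows "X \<bullet> Y = (\<Sum>j\<in>UNIV. column j X \<bullet> column j Y)"
  unfolding inner_vec_def column_def by (simp add: sum.swap[of _ "UNIV::'k set"])

lemma inner_matrix_mult_left: "(A ** X) \<bullet> Y = X \<bullet> (transpose A ** Y)"
  for A :: "real^'m^'n" and X :: "real^'k^'m"
proof -
  have "(A *v x) \<bullet> y = x \<bullet> (transpose A *v y)" for x y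
    using inner_transpose_left[of A y x] by (simp add: inner_commute)
  then show ?thesis by (simp add: inner_matrix_columns column_matrix_mult)
qed

lemma inner_matrix_transpose: "transpose X \<bullet> transpose Y = X \<bullet> Y" for X :: "real^'k^'n"
  unfolding inner_vec_def transpose_def by (simp add: sum.swap[of _ "UNIV::'k set"])

lemma inner_matrix_mult_right: "(X ** B) \<bullet> Y = X \<bullet> (Y ** transpose B)"
  for B :: "real^'m^'k" and X :: "real^'k^'n"
proof -
  have "(X ** B) \<bullet> Y = (transpose B ** transpose X) \<bullet> transpose Y"
    using inner_matrix_transpose[of "X ** B" Y] by (simp only: matrix_transpose_mul)
  also have "\<dots> = transpose X \<bullet> transpose (Y ** transpose B)"
    by (simp only: inner_matrix_mult_left matrix_transpose_mul)
  finally show ?thesis by (simp only: inner_matrix_transpose)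
qed

lemma trace_transpose_mult: "trace (transpose X ** Y) = X \<bullet> Y" for X :: "real^'k^'n"
  unfolding trace_def inner_matrix_columns
  by (simp add: matrix_matrix_mult_def transpose_def inner_vec_def column_def)

lemma transpose_mult_eq_iff_columns:
  fixes U :: "real^'k^'m"
  shows "transpose U ** U = mat 1 \<longleftrightarrow> (\<forall>i j. column i U \<bullet> column j U = (if i = j then 1 else 0))"
  by (simp add: matrix_mult_transpose_dot_column vec_eq_iff mat_def)

lemma inner_orthonormal_columns: "transpose X ** X = mat 1 \<Longrightarrow> X \<bullet> X = CARD('k)" for X :: "real^'k^'n"
  using trace_transpose_mult[of X X] by (simp add: trace_I)

lemma matrix_vector_norm_le_frobenius: "(M *v w) \<bullet> (M *v w) \<le> (M \<bullet> M) * (w \<bullet> w)" for M :: "real^'k^'n"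
proof -
  have "(M *v w) \<bullet> (M *v w) = (\<Sum>i\<in>UNIV. (M $ i \<bullet> w)\<^sup>2)"
    by (simp add: inner_vec_def[of "M *v w"] matrix_vector_mul_component power2_eq_square)
  also have "\<dots> \<le> (\<Sum>i\<in>UNIV. (M $ i \<bullet> M $ i) * (w \<bullet> w))"
    by (intro sum_mono Cauchy_Schwarz_ineq)
  also have "\<dots> = (M \<bullet> M) * (w \<bullet> w)"
    by (simp add: inner_vec_def[of M] sum_distrib_right)
  finally show ?thesis .
qed

section \<open>Matrices with orthonormal columns\<close>

lemma inner_isometry: "transpose V ** V = mat 1 \<Longrightarrow> (V *v x) \<bullet> (V *v y) = x \<bullet> y" for V :: "real^'k^'n"
  by (metis inner_transpose_right matrix_vector_mul_assoc matrix_vector_mul_lid)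

text \<open>Pythagoras for the projector \<open>V V\<^sup>T\<close>. It turns every inequality between a vector and its
  projection, in particular \<open>|V\<^sup>T z| \<le> |z|\<close>, into nonnegativity of a square.\<close>

lemma inner_projection_defect:
  fixes V :: "real^'k^'n"
  assumes "transpose V ** V = mat 1"
  shows "(z - V *v (transpose V *v z)) \<bullet> (z - V *v (transpose V *v z)) = z \<bullet> z - (transpose V *v z) \<bullet> (transpose V *v z)"
  by (simp add: inner_diff_left inner_diff_right inner_isometry[OF assms] inner_transpose_right inner_commute)

lemma projector_fixes_span:
  fixes Y :: "real^'k^'n"
  assumes "transpose Y ** Y = mat 1" "x \<in> span (columns Y)"
  shows "Y *v (transpose Y *v x) = x"
  using assms(2)
proof (induction rule: span_induct)
  case base
  show ?case
    by (auto simp: subspace_def matrix_vector_right_distrib matrix_vector_mult_scaleR)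
next
  case (step x)
  then obtain j where j: "x = Y *v axis j 1"
    by (auto simp: columns_def simp flip: matrix_vector_mult_basis)
  have "Y *v (transpose Y *v x) = Y *v ((transpose Y ** Y) *v axis j 1)"
    by (simp only: j matrix_vector_mul_assoc)
  then show ?case by (simp add: assms(1) j)
qed

section \<open>Singular value decomposition\<close>

text \<open>A maximiser of the Rayleigh quotient on the unit sphere of \<open>S\<close> is an eigenvector.\<close>

lemma selfadjoint_has_eigenvector:
  fixes f :: "'a::euclidean_space \<Rightarrow> 'a"
  assumes "linear f" and sa: "\<And>x y. f x \<bullet> y = x \<bullet> f y"
    and S: "subspace S" "f ` S \<subseteq> S" "S \<noteq> {0}"
  obtains x \<mu> where "x \<in> S" "norm x = 1" "f x = \<mu> *\<^sub>R x"
proof -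
  let ?K = "S \<inter> sphere 0 1"
  have "compact ?K"
    by (simp add: S(1) closed_subspace closed_Int_compact)
  moreover obtain z where "z \<in> S" "z \<noteq> 0"
    using S subspace_0 by blast
  then have "z /\<^sub>R norm z \<in> ?K"
    by (simp add: S(1) subspace_scale)
  moreover have cont: "continuous_on ?K (\<lambda>x. x \<bullet> f x)"
    using linear_continuous_on[OF \<open>linear f\<close>[unfolded linear_conv_bounded_linear]]
    by (intro continuous_intros)
  ultimately obtain x where x: "x \<in> ?K" and max: "\<And>y. y \<in> ?K \<Longrightarrow> y \<bullet> f y \<le> x \<bullet> f x"
    using continuous_attains_sup[of ?K "\<lambda>x. x \<bullet> f x"] by (metis (no_types, lifting) empty_iff)
  define \<mu> where "\<mu> = x \<bullet> f x"
  have le: "y \<bullet> f y \<le> \<mu> * (y \<bullet> y)" if "y \<in> S" for y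
  proof (cases "y = 0")
    case False
    then have "y /\<^sub>R norm y \<in> ?K"
      by (simp add: S(1) subspace_scale that)
    from max[OF this] False show ?thesis
      by (simp add: linear_scale[OF \<open>linear f\<close>] \<mu>_def[symmetric] divide_simps dot_square_norm power2_eq_square mult.commute)
  qed simp
  define g where "g = \<mu> *\<^sub>R x - f x"
  have gS: "g \<in> S"
    using x S unfolding g_def by (intro subspace_diff subspace_scale) auto
  have xx: "x \<bullet> x = 1" using x by (simp add: dot_square_norm)
  have "g = 0"
  proof (rule ccontr)
    assume "g \<noteq> 0"
    \<comment> \<open>The quadratic form \<open>y \<mapsto> \<mu> |y|\<^sup>2 - y \<bullet> f y\<close> is nonnegative on \<open>S\<close> and vanishes at \<open>x\<close>;
      moving from \<open>x\<close> against its gradient \<open>2 g\<close> would make it negative.\<close>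
    define q where "q = \<mu> * (g \<bullet> g) - g \<bullet> f g"
    define t where "t = (g \<bullet> g) / (1 + q)"
    have q: "0 \<le> q" using le[OF gS] by (simp add: q_def)
    have "x - t *\<^sub>R g \<in> S" using x gS S(1) by (auto intro!: subspace_diff subspace_scale)
    note le[OF this]
    moreover have "x \<bullet> f g = g \<bullet> f x" using sa by (metis inner_commute)
    moreover have "g \<bullet> f x = \<mu> * (g \<bullet> x) - g \<bullet> g"
      by (simp add: g_def algebra_simps inner_diff_right)
    ultimately have "2 * t * (g \<bullet> g) \<le> t\<^sup>2 * q"
      by (simp add: linear_diff[OF \<open>linear f\<close>] linear_scale[OF \<open>linear f\<close>] inner_diff_left inner_diff_right
          xx \<mu>_def[symmetric] q_def algebra_simps power2_eq_square inner_commute)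
    moreover have "0 < t" using q \<open>g \<noteq> 0\<close> by (simp add: t_def add_nonneg_pos divide_pos_pos)
    ultimately have "2 * (g \<bullet> g) \<le> t * q" by (simp add: power2_eq_square)
    also have "\<dots> \<le> g \<bullet> g" using q by (simp add: t_def divide_simps mult_left_mono)
    finally show False using \<open>g \<noteq> 0\<close> by (simp add: leD)
  qed
  then show ?thesis using that[of x \<mu>] x by (auto simp: g_def)
qed

text \<open>Split off one eigenvector; its orthogonal complement within \<open>S\<close> is again invariant.\<close>

lemma selfadjoint_has_orthonormal_eigenbasis:
  fixes f :: "'a::euclidean_space \<Rightarrow> 'a"
  assumes "linear f" and sa: "\<And>x y. f x \<bullet> y = x \<bullet> f y"
    and S: "subspace S" "f ` S \<subseteq> S"
  shows "\<exists>B. B \<subseteq> S \<and> finite B \<and> card B = dim S \<and> pairwise orthogonal B \<and>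
             (\<forall>b\<in>B. norm b = 1 \<and> (\<exists>\<mu>. f b = \<mu> *\<^sub>R b))"
  using S
proof (induction "dim S" arbitrary: S)
  case 0
  then show ?case by (intro exI[of _ "{}"]) auto
next
  case (Suc d)
  then have "S \<noteq> {0}" by auto
  then obtain x \<mu> where x: "x \<in> S" "norm x = 1" "f x = \<mu> *\<^sub>R x"
    using selfadjoint_has_eigenvector[OF \<open>linear f\<close> sa Suc.prems] by metis
  define T where "T = {y \<in> S. orthogonal x y}"
  have T: "subspace T"
    using Suc.prems(1) unfolding T_def
    by (auto simp: subspace_def orthogonal_def inner_add_right)
  have "f ` T \<subseteq> T"
    using Suc.prems x(3) by (auto simp: T_def orthogonal_def simp flip: sa)
  moreover have "dim T + dim (span {x}) = dim S"
  proof -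
    have "T = {y \<in> S. \<forall>z\<in>span {x}. orthogonal z y}"
      by (auto simp: T_def span_singleton orthogonal_def)
    moreover have "span {x} \<subseteq> S" by (simp add: span_minimal x(1) Suc.prems(1))
    ultimately show ?thesis
      using dim_subspace_orthogonal_to_vectors[of "span {x}" S] Suc.prems(1) by simp
  qed
  then have "d = dim T" using Suc.hyps(2) x(2) by (auto simp: dim_singleton split: if_splits)
  ultimately obtain B where B: "B \<subseteq> T" "finite B" "card B = dim T" "pairwise orthogonal B"
    "\<forall>b\<in>B. norm b = 1 \<and> (\<exists>\<mu>. f b = \<mu> *\<^sub>R b)"
    using Suc.hyps(1)[of T] T by blast
  have "x \<notin> B" using B(1) x(2) by (auto simp: T_def orthogonal_def dot_square_norm)
  moreover have "pairwise orthogonal (insert x B)"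
    using B(1,4) by (auto simp: pairwise_insert T_def orthogonal_commute)
  ultimately show ?case
    using B x Suc.hyps(2) \<open>d = dim T\<close> by (intro exI[of _ "insert x B"]) (auto simp: T_def)
qed

lemma diag_mult_column: "column j (U ** diag d) = d $ j *\<^sub>R column j U"
  by (simp add: vec_eq_iff column_def matrix_matrix_mult_def diag_def if_distrib cong: if_cong)

text \<open>An orthonormal eigenbasis of \<open>M\<^sup>T M\<close> is mapped by \<open>M\<close> to pairwise orthogonal vectors. The lengths
  of these images are the singular values. By existence the choices in the definitions of singular
  values and of the exponential map select genuine decompositions, and the estimates below hold for each of
  these.\<close>

lemma compact_svd_exists:
  fixes M :: "real^'k^'m"
  assumes km: "CARD('k) \<le> CARD('m)"
  shows "\<exists>U \<sigma> V. compact_svd M U \<sigma> V"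
proof -
  define f where "f x = transpose M *v (M *v x)" for x
  have "linear f" unfolding f_def
    by (simp add: linear_iff matrix_vector_right_distrib matrix_vector_mult_scaleR)
  moreover have "f x \<bullet> y = x \<bullet> f y" for x y
    by (metis f_def inner_commute inner_transpose_left)
  ultimately obtain B where B: "finite B" "card B = CARD('k)" "pairwise orthogonal B"
     "\<And>b. b \<in> B \<Longrightarrow> norm b = 1" "\<And>b. b \<in> B \<Longrightarrow> \<exists>\<mu>. f b = \<mu> *\<^sub>R b"
    using selfadjoint_has_orthonormal_eigenbasis[of f UNIV] by auto
  obtain w where w: "bij_betw w (UNIV::'k set) B"
    using B finite_same_card_bij[of "UNIV::'k set" B] by auto
  have wB: "w i \<in> B" for i using w by (auto simp: bij_betw_def)
  have ww: "w i \<bullet> w j = (if i = j then 1 else 0)" for i j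
  proof (cases "i = j")
    case False
    then have "w i \<noteq> w j" using w by (auto simp: bij_betw_def inj_def)
    then show ?thesis using pairwiseD[OF B(3) wB wB] False by (simp add: orthogonal_def)
  qed (simp add: dot_square_norm B(4) wB)
  define \<sigma> :: "real^'k" where "\<sigma> = (\<chi> i. norm (M *v w i))"
  have MM: "(M *v w i) \<bullet> (M *v w j) = 0" if "i \<noteq> j" for i j
  proof -
    obtain \<mu> where "f (w i) = \<mu> *\<^sub>R w i" using B(5) wB by blast
    then show ?thesis using that ww[of i j] inner_transpose_left[of M "M *v w i" "w j"] by (simp add: f_def)
  qed
  define J where "J = {i. \<sigma> $ i \<noteq> 0}"
  define g where "g i = (M *v w i) /\<^sub>R (\<sigma> $ i)" for i
  have gg: "g i \<bullet> g j = (if i = j then 1 else 0)" if "i \<in> J" for i j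
    using that MM[of i j] by (auto simp: J_def g_def \<sigma>_def dot_square_norm power2_eq_square field_simps)
  \<comment> \<open>The normalised images are completed to \<open>k\<close> orthonormal vectors inside their orthogonal complement,
    which has dimension at least \<open>k - |J|\<close> because \<open>k \<le> m\<close>.\<close>
  define T where "T = {y. \<forall>z\<in>span (g ` J). orthogonal z y}"
  have "dim T + dim (span (g ` J)) = CARD('m)"
    using dim_subspace_orthogonal_to_vectors[of "span (g ` J)" UNIV] by (simp add: T_def)
  moreover have "dim (span (g ` J)) \<le> card J"
    by (metis card_image_le dim_le_card' dim_span finite_class.finite finite_imageI order_trans)
  ultimately have dimT: "card (- J) \<le> dim T"
    using km by (simp add: Compl_eq_Diff_UNIV card_Diff_subset)
  have "subspace T" unfolding T_def
    by (auto simp: subspace_def orthogonal_def inner_add_right)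
  then obtain C where C: "C \<subseteq> T" "pairwise orthogonal C" "\<And>x. x \<in> C \<Longrightarrow> norm x = 1"
      "independent C" "card C = dim T"
    using orthonormal_basis_subspace by metis
  then obtain h where h: "h ` (- J) \<subseteq> C" "inj_on h (- J)"
    using card_le_inj[of "- J" C] dimT by (metis finite_class.finite independent_imp_finite)
  have hh: "h i \<bullet> h j = (if i = j then 1 else 0)" if "i \<notin> J" "j \<notin> J" for i j
  proof (cases "i = j")
    case False
    then have "h i \<noteq> h j" using h(2) that by (auto simp: inj_on_def)
    then show ?thesis using pairwiseD[OF C(2), of "h i" "h j"] h(1) that False by (auto simp: orthogonal_def)
  next
    case True
    then show ?thesis using C(3)[of "h i"] h(1) that by (auto simp: dot_square_norm)
  qed
  have gh: "g i \<bullet> h j = 0" if "i \<in> J" "j \<notin> J" for i j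
  proof -
    have "h j \<in> T" using C(1) h(1) that by auto
    moreover have "g i \<in> span (g ` J)" by (simp add: span_base that)
    ultimately show ?thesis by (simp add: T_def orthogonal_def)
  qed
  define u where "u i = (if i \<in> J then g i else h i)" for i
  have uu: "u i \<bullet> u j = (if i = j then 1 else 0)" for i j
    using gg[of i j] hh[of i j] gh[of i j] gh[of j i] by (auto simp: u_def inner_commute)
  define U :: "real^'k^'m" where "U = (\<chi> r i. u i $ r)"
  define V :: "real^'k^'k" where "V = (\<chi> r i. w i $ r)"
  have colU: "column i U = u i" and colV: "column i V = w i" for i
    by (simp_all add: U_def V_def column_def vec_eq_iff)
  have U: "transpose U ** U = mat 1" and V: "transpose V ** V = mat 1"
    by (simp_all add: transpose_mult_eq_iff_columns colU colV uu ww)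
  have "column i (M ** V) = column i (U ** diag \<sigma>)" for i
    unfolding column_matrix_mult[of i M V] diag_mult_column colU colV
    by (auto simp: u_def g_def J_def \<sigma>_def)
  then have "M ** V = U ** diag \<sigma>"
    by (simp add: vec_eq_iff column_def)
  then have "M = U ** diag \<sigma> ** transpose V"
    using V by (metis matrix_left_right_inverse matrix_mul_assoc matrix_mul_rid)
  then show ?thesis
    using U V unfolding compact_svd_def orthogonal_matrix by (metis \<sigma>_def norm_ge_zero vec_lambda_beta)
qed

section \<open>A second-order bound along geodesics\<close>

lemma objective_eq_inner: "objective A X = - (X \<bullet> (A ** X))"
  by (simp add: objective_def trace_transpose_mult flip: matrix_mul_assoc)

text \<open>Rotating \<open>q\<close> towards \<open>u\<close> at unit speed, the point \<open>y\<close> and its velocity \<open>y'\<close> are unit vectors, and the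
  second derivative of \<open>y \<bullet> H y\<close> is \<open>2 (y' \<bullet> H y' - y \<bullet> H y) \<ge> - 2 (M - m)\<close>. Integrating twice gives
  the bound.\<close>

lemma quadratic_form_along_rotation:
  fixes q u :: "real^'n" and H :: "real^'n^'n"
  assumes sym: "transpose H = H"
    and bounds: "\<And>x. m * (x \<bullet> x) \<le> x \<bullet> (H *v x)" "\<And>x. x \<bullet> (H *v x) \<le> M * (x \<bullet> x)"
    and qu: "q \<bullet> q = 1" "u \<bullet> u = 1" "q \<bullet> u = 0" and "0 \<le> \<sigma>"
  shows "q \<bullet> (H *v q) + 2 * (q \<bullet> (H *v (\<sigma> *\<^sub>R u))) - (M - m) * \<sigma>\<^sup>2
           \<le> (cos \<sigma> *\<^sub>R q + sin \<sigma> *\<^sub>R u) \<bullet> (H *v (cos \<sigma> *\<^sub>R q + sin \<sigma> *\<^sub>R u))"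
proof -
  define a b c where "a = q \<bullet> (H *v q)" and "b = u \<bullet> (H *v u)" and "c = q \<bullet> (H *v u)"
  have c': "u \<bullet> (H *v q) = c"
    unfolding c_def by (metis sym inner_transpose_left inner_commute)
  have expand: "(x *\<^sub>R q + y *\<^sub>R u) \<bullet> (H *v (x *\<^sub>R q + y *\<^sub>R u)) = x\<^sup>2 * a + y\<^sup>2 * b + 2 * x * y * c" for x y
    by (simp add: matrix_vector_right_distrib matrix_vector_mult_scaleR inner_add_left inner_add_right
        a_def[symmetric] b_def[symmetric] c_def[symmetric] c' power2_eq_square algebra_simps)
  have unit: "(x *\<^sub>R q + y *\<^sub>R u) \<bullet> (x *\<^sub>R q + y *\<^sub>R u) = x\<^sup>2 + y\<^sup>2" for x y
    using qu by (simp add: inner_add_left inner_add_right inner_commute power2_eq_square)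
  \<comment> \<open>\<open>e\<close> is the difference of the two sides at angle \<open>s\<close>, and \<open>d\<close> is its derivative.\<close>
  define d where "d s = 2 * sin s * cos s * (b - a) + 2 * ((cos s)\<^sup>2 - (sin s)\<^sup>2) * c - 2 * c + 2 * (M - m) * s" for s :: real
  define e where "e s = (cos s)\<^sup>2 * a + (sin s)\<^sup>2 * b + 2 * cos s * sin s * c - a - 2 * c * s + (M - m) * s\<^sup>2" for s :: real
  have d: "0 \<le> d s" if "0 \<le> s" for s :: real
  proof -
    have "d 0 \<le> d s"
    proof (rule DERIV_nonneg_imp_nondecreasing[OF that])
      fix s :: real
      let ?d' = "2 * ((cos s)\<^sup>2 - (sin s)\<^sup>2) * (b - a) - 8 * sin s * cos s * c + 2 * (M - m)"
      have "(d has_real_derivative ?d') (at s)"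
        unfolding d_def by (auto intro!: derivative_eq_intros simp: power2_eq_square algebra_simps)
      moreover have "0 \<le> ?d'"
        using bounds(1)[of "(- sin s) *\<^sub>R q + cos s *\<^sub>R u"] bounds(2)[of "cos s *\<^sub>R q + sin s *\<^sub>R u"]
        unfolding expand unit by (simp add: algebra_simps)
      ultimately show "\<exists>y. (d has_real_derivative y) (at s) \<and> 0 \<le> y" by blast
    qed
    then show ?thesis by (simp add: d_def)
  qed
  have "e 0 \<le> e \<sigma>"
  proof (rule DERIV_nonneg_imp_nondecreasing[OF \<open>0 \<le> \<sigma>\<close>])
    fix s :: real assume "0 \<le> s"
    have "(e has_real_derivative d s) (at s)"
      unfolding e_def d_def by (auto intro!: derivative_eq_intros simp: power2_eq_square algebra_simps)
    with d[OF \<open>0 \<le> s\<close>] show "\<exists>y. (e has_real_derivative y) (at s) \<and> 0 \<le> y" by blast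
  qed
  then show ?thesis
    unfolding expand by (simp add: e_def matrix_vector_mult_scaleR a_def[symmetric] c_def[symmetric] algebra_simps)
qed

text \<open>Both matrices have the same projector \<open>X X\<^sup>T = Y Y\<^sup>T\<close>, and the trace depends on nothing else. So any
  representative of the next iterate may be replaced by the one that the exponential map constructs.\<close>

lemma inner_matrix_same_span:
  fixes X Y :: "real^'k^'n"
  assumes "represents X S" "represents Y S"
  shows "X \<bullet> (H ** X) = Y \<bullet> (H ** Y)"
proof -
  have fixed: "Z ** transpose Z ** W = W"
    if "represents Z S" "represents W S" for Z W :: "real^'k^'n"
  proof -
    have "column j (Z ** transpose Z ** W) = column j W" for j
    proof -
      have "column j W \<in> span (columns Z)"
        using that by (auto simp: represents_def columns_def intro: span_base)
      then show ?thesis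
        using that(1) projector_fixes_span[of Z "column j W"]
        by (simp add: column_matrix_mult represents_def matrix_vector_mul_assoc)
    qed
    then show ?thesis by (simp add: vec_eq_iff column_def)
  qed
  let ?P = "X ** transpose X" and ?Q = "Y ** transpose Y"
  have "?P ** ?Q = ?Q" "?Q ** ?P = ?P"
    using fixed[of X Y] fixed[of Y X] assms by (simp_all add: matrix_mul_assoc)
  then have "?P = ?Q"
    using matrix_transpose_mul[of ?P ?Q] matrix_transpose_mul[of X "transpose X"] matrix_transpose_mul[of Y "transpose Y"]
    by (simp only: transpose_transpose)
  moreover have "Z \<bullet> (H ** Z) = H \<bullet> (Z ** transpose Z)" for Z :: "real^'k^'n"
    using inner_matrix_mult_right[of H Z Z]
    by (metis inner_commute inner_matrix_mult_right transpose_transpose)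
  ultimately show ?thesis by simp
qed

text \<open>In the bases given by a singular value decomposition \<open>G = U \<Sigma> W\<^sup>T\<close>, the geodesic rotates each column of
  \<open>X W\<close> towards the corresponding column of \<open>U\<close> by the angle \<open>\<sigma>\<^sub>i\<close>. The planes of rotation are mutually
  orthogonal, so the bound for a single rotation can be summed over the columns, with
  \<open>\<Sum> \<sigma>\<^sub>i\<^sup>2 = |G|\<^sup>2\<close>.\<close>

lemma grassmann_exp_second_order_bound:
  fixes X X' G :: "real^'k^'n" and H :: "real^'n^'n"
  assumes kn: "CARD('k) \<le> CARD('n)"
    and X: "transpose X ** X = mat 1" and tangent: "transpose X ** G = 0"
    and X': "represents X' (grassmann_exp X G)"
    and sym: "transpose H = H"
    and bounds: "\<And>x. m * (x \<bullet> x) \<le> x \<bullet> (H *v x)" "\<And>x. x \<bullet> (H *v x) \<le> M * (x \<bullet> x)"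
  shows "X \<bullet> (H ** X) + 2 * (X \<bullet> (H ** G)) - (M - m) * (G \<bullet> G) \<le> X' \<bullet> (H ** X')"
proof -
  obtain U0 \<sigma>0 W0 where "compact_svd G U0 \<sigma>0 W0"
    using compact_svd_exists[OF kn] by blast
  then have "\<exists>S U \<sigma> W. compact_svd G U \<sigma> W \<and>
      S = span (columns (X ** W ** diag (\<chi> i. cos (\<sigma> $ i)) + U ** diag (\<chi> i. sin (\<sigma> $ i))))"
    by blast
  from someI_ex[OF this] obtain U \<sigma> W where svd: "compact_svd G U \<sigma> W"
    and span: "grassmann_exp X G
       = span (columns (X ** W ** diag (\<chi> i. cos (\<sigma> $ i)) + U ** diag (\<chi> i. sin (\<sigma> $ i))))"
    unfolding grassmann_exp_def by blast
  define Y where "Y = X ** W ** diag (\<chi> i. cos (\<sigma> $ i)) + U ** diag (\<chi> i. sin (\<sigma> $ i))"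
  have W: "transpose W ** W = mat 1" "W ** transpose W = mat 1"
    and \<sigma>: "\<And>i. 0 \<le> \<sigma> $ i"
    using svd by (auto simp: compact_svd_def orthogonal_matrix_def)
  define q where "q i = column i (X ** W)" for i
  define u where "u i = column i U" for i
  have colY: "column i Y = cos (\<sigma> $ i) *\<^sub>R q i + sin (\<sigma> $ i) *\<^sub>R u i" for i
  proof -
    have "column i Y = column i (X ** W ** diag (\<chi> i. cos (\<sigma> $ i))) + column i (U ** diag (\<chi> i. sin (\<sigma> $ i)))"
      by (simp add: Y_def column_def vec_eq_iff)
    then show ?thesis by (simp only: diag_mult_column q_def u_def vec_lambda_beta)
  qed
  have "G ** W = U ** diag \<sigma> ** (transpose W ** W)"
    using svd by (simp add: compact_svd_def matrix_mul_assoc)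
  then have GW: "G ** W = U ** diag \<sigma>" by (simp add: W)
  then have colGW: "G *v column i W = \<sigma> $ i *\<^sub>R u i" for i
    using diag_mult_column[of i U \<sigma>] column_matrix_mult[of i G W] by (simp add: u_def)
  have "transpose (X ** W) ** (X ** W) = transpose W ** (transpose X ** X) ** W"
    by (simp add: matrix_transpose_mul matrix_mul_assoc)
  then have qq: "q i \<bullet> q j = (if i = j then 1 else 0)" for i j
    using transpose_mult_eq_iff_columns[of "X ** W"] by (simp add: X W q_def)
  have uu: "u i \<bullet> u j = (if i = j then 1 else 0)" for i j
    using svd transpose_mult_eq_iff_columns[of U] by (simp add: compact_svd_def u_def)
  \<comment> \<open>A column of \<open>U\<close> with singular value zero need not be orthogonal to \<open>X\<close>, but it enters with the factor
    \<open>sin 0\<close>.\<close>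
  have qu: "q i \<bullet> u j = 0" if "\<sigma> $ j \<noteq> 0" for i j
  proof -
    have "q i \<bullet> (G *v x) = column i W \<bullet> ((transpose X ** G) *v x)" for x
      by (metis column_matrix_mult inner_commute inner_transpose_left matrix_vector_mul_assoc q_def)
    then have "q i \<bullet> (\<sigma> $ j *\<^sub>R u j) = 0" by (simp add: tangent flip: colGW)
    then show ?thesis using that by simp
  qed
  have uq: "sin (\<sigma> $ j) * (q i \<bullet> u j) = 0" "sin (\<sigma> $ j) * (u j \<bullet> q i) = 0" for i j
    using qu[of j i] by (cases "\<sigma> $ j = 0"; simp add: inner_commute)+
  have "column i Y \<bullet> column j Y = (if i = j then 1 else 0)" for i j
  proof -
    have "column i Y \<bullet> column j Y
        = cos (\<sigma> $ i) * cos (\<sigma> $ j) * (q i \<bullet> q j) + sin (\<sigma> $ i) * sin (\<sigma> $ j) * (u i \<bullet> u j)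
          + cos (\<sigma> $ i) * (sin (\<sigma> $ j) * (q i \<bullet> u j)) + cos (\<sigma> $ j) * (sin (\<sigma> $ i) * (u i \<bullet> q j))"
      by (simp add: colY inner_add_left inner_add_right algebra_simps)
    also have "\<dots> = (if i = j then 1 else 0)"
      unfolding uq by (simp add: qq uu)
    finally show ?thesis .
  qed
  then have "represents Y (grassmann_exp X G)"
    unfolding represents_def transpose_mult_eq_iff_columns using span by (simp add: Y_def)
  note X'Y = inner_matrix_same_span[OF X' this]
  have col: "q i \<bullet> (H *v q i) + 2 * (q i \<bullet> (H *v (\<sigma> $ i *\<^sub>R u i))) - (M - m) * (\<sigma> $ i)\<^sup>2
      \<le> column i Y \<bullet> (H *v column i Y)" for i
  proof (cases "\<sigma> $ i = 0")
    case False
    then show ?thesis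
      unfolding colY using quadratic_form_along_rotation[OF sym bounds, of "q i" "u i" "\<sigma> $ i"] \<sigma>
      by (simp add: qq uu qu)
  qed (simp add: colY)
  have sum_cols: "(A ** W) \<bullet> (B ** W) = A \<bullet> B" for A B :: "real^'k^'n"
    by (simp add: inner_matrix_mult_right W flip: matrix_mul_assoc)
  have "X \<bullet> (H ** X) = (\<Sum>i\<in>UNIV. q i \<bullet> (H *v q i))"
    using sum_cols[of X "H ** X"] unfolding inner_matrix_columns[of "X ** W"] q_def
    by (simp add: column_matrix_mult flip: matrix_vector_mul_assoc)
  moreover have "X \<bullet> (H ** G) = (\<Sum>i\<in>UNIV. q i \<bullet> (H *v (\<sigma> $ i *\<^sub>R u i)))"
    using sum_cols[of X "H ** G"] unfolding inner_matrix_columns[of "X ** W"] q_def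
    by (simp add: column_matrix_mult flip: colGW matrix_vector_mul_assoc)
  moreover have "G \<bullet> G = (\<Sum>i\<in>UNIV. (\<sigma> $ i)\<^sup>2)"
    using sum_cols[of G G] unfolding inner_matrix_columns[of "G ** W"]
    by (simp add: column_matrix_mult colGW uu power2_eq_square)
  moreover have "Y \<bullet> (H ** Y) = (\<Sum>i\<in>UNIV. column i Y \<bullet> (H *v column i Y))"
    unfolding inner_matrix_columns by (simp add: column_matrix_mult)
  moreover note sum_mono[of UNIV, OF col]
  ultimately show ?thesis
    unfolding X'Y by (simp add: sum.distrib sum_subtractf flip: sum_distrib_left)
qed

section \<open>Principal angles and the overlap of two subspaces\<close>

text \<open>For orthonormal columns this is the sum of the squared cosines of the principal angles.\<close>

definition overlap :: "real^'k^'n \<Rightarrow> real^'k^'n \<Rightarrow> real" where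
  "overlap V X = (transpose V ** X) \<bullet> (transpose V ** X)"

lemma overlap_eq_inner: "X \<bullet> ((V ** transpose V) ** X) = overlap V X" for V X :: "real^'k^'n"
  unfolding overlap_def inner_matrix_mult_left by (simp add: matrix_mul_assoc)

lemma overlap_commute: "overlap V X = overlap X V" for V X :: "real^'k^'n"
proof -
  have "transpose X ** V = transpose (transpose V ** X)"
    by (simp add: matrix_transpose_mul)
  then show ?thesis unfolding overlap_def by (simp only: inner_matrix_transpose)
qed

text \<open>Each squared sine of a principal angle is at most the sum of all of them. In this way a
  bound on the overlap, which the iteration controls, becomes a bound on every single cosine.\<close>

lemma overlap_controls_smallest_cosine:
  fixes V X :: "real^'k^'n"
  assumes V: "transpose V ** V = mat 1" and X: "transpose X ** X = mat 1"
  shows "(1 - (CARD('k) - overlap V X)) * (w \<bullet> w) \<le> (transpose V *v (X *v w)) \<bullet> (transpose V *v (X *v w))"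
proof -
  define M where "M = X - V ** transpose V ** X"
  have "M \<bullet> M = X \<bullet> X - overlap V X"
  proof -
    have "(V ** transpose V ** X) \<bullet> (V ** transpose V ** X) = X \<bullet> (V ** (transpose V ** V) ** transpose V ** X)"
      by (simp add: inner_matrix_mult_left matrix_transpose_mul matrix_mul_assoc)
    then show ?thesis
      by (simp add: M_def inner_diff_left inner_diff_right V overlap_eq_inner inner_commute[of "V ** transpose V ** X" X])
  qed
  then have "(M *v w) \<bullet> (M *v w) \<le> (CARD('k) - overlap V X) * (w \<bullet> w)"
    using matrix_vector_norm_le_frobenius[of M w] by (simp add: inner_orthonormal_columns[OF X])
  moreover have "M *v w = X *v w - V *v (transpose V *v (X *v w))"
    by (simp add: M_def matrix_vector_mult_diff_rdistrib matrix_vector_mul_assoc matrix_mul_assoc)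
  ultimately show ?thesis
    using inner_projection_defect[OF V, of "X *v w"] by (simp add: inner_isometry[OF X] algebra_simps)
qed

text \<open>The squared norm on the left is \<open>\<Sum> sin\<^sup>2 \<theta>\<^sub>i cos\<^sup>2 \<theta>\<^sub>i\<close>, and the right-hand side is
  \<open>\<Sum> sin\<^sup>2 \<theta>\<^sub>i\<close>. With \<open>C = V\<^sup>T X\<close> the difference is \<open>|I - C\<^sup>T C|\<^sup>2\<close>.\<close>

lemma tangential_part_of_projection_le:
  fixes V X :: "real^'k^'n"
  assumes V: "transpose V ** V = mat 1" and X: "transpose X ** X = mat 1"
  defines "D \<equiv> (mat 1 - X ** transpose X) ** (V ** transpose V ** X)"
  shows "D \<bullet> D \<le> CARD('k) - overlap V X"
proof -
  define C where "C = transpose V ** X"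
  have D: "D = V ** C - X ** (transpose C ** C)"
    by (simp add: D_def C_def matrix_diff_rdistrib matrix_transpose_mul matrix_mul_assoc)
  have tX: "transpose X ** V = transpose C" by (simp add: C_def matrix_transpose_mul)
  have "(V ** C) \<bullet> (V ** C) = C \<bullet> C"
    by (simp add: inner_matrix_mult_left matrix_mul_assoc V)
  moreover have "(X ** (transpose C ** C)) \<bullet> (X ** (transpose C ** C)) = (transpose C ** C) \<bullet> (transpose C ** C)"
    unfolding inner_matrix_mult_left[of X] by (simp add: matrix_mul_assoc X)
  moreover have "(X ** (transpose C ** C)) \<bullet> (V ** C) = (transpose C ** C) \<bullet> (transpose C ** C)"
    unfolding inner_matrix_mult_left[of X] by (simp add: matrix_mul_assoc tX)
  ultimately have DD: "D \<bullet> D = C \<bullet> C - (transpose C ** C) \<bullet> (transpose C ** C)"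
    by (simp add: D inner_diff_left inner_diff_right inner_commute[of "V ** C" "X ** _"])
  define E where "E = transpose C ** C"
  have "(mat 1 - E) \<bullet> (mat 1 - E) = CARD('k) - 2 * (mat 1 \<bullet> E) + E \<bullet> E"
    using inner_orthonormal_columns[of "mat 1 :: real^'k^'k"]
    by (simp add: inner_diff_left inner_diff_right inner_commute)
  moreover have "mat 1 \<bullet> E = C \<bullet> C"
    unfolding E_def using inner_matrix_mult_left[of C "mat 1" C] by simp
  ultimately show ?thesis
    using inner_ge_zero[of "mat 1 - E"] DD by (simp add: E_def overlap_def C_def)
qed

text \<open>The orthogonal complements of two subspaces form the same nonzero principal angles as the subspaces
  themselves. Here this is needed as follows: the part \<open>z = p - X X\<^sup>T p\<close> of a vector \<open>p\<close> of the column space of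
  \<open>V\<close> lies in the complement of \<open>X\<close>, and the right-hand side equals \<open>|z|\<^sup>2 - |V\<^sup>T z|\<^sup>2\<close>, the squared distance
  of \<open>z\<close> from the column space of \<open>V\<close>.\<close>

lemma complementary_cosine_bound:
  fixes V X :: "real^'k^'n"
  assumes V: "transpose V ** V = mat 1" and X: "transpose X ** X = mat 1"
    and cos: "\<And>y. c * (y \<bullet> y) \<le> (transpose X *v (V *v y)) \<bullet> (transpose X *v (V *v y))"
    and p: "V *v (transpose V *v p) = p"
  defines "a \<equiv> transpose X *v p"
  shows "c * (p \<bullet> p - a \<bullet> a) \<le> a \<bullet> a - (transpose V *v (X *v a)) \<bullet> (transpose V *v (X *v a))"
proof -
  define z where "z = p - X *v a"
  define y where "y = transpose V *v z"
  have Xz: "transpose X *v z = 0"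
    by (simp add: z_def a_def matrix_vector_mult_diff_distrib matrix_vector_mul_assoc X matrix_mul_assoc)
  have zz: "z \<bullet> z = p \<bullet> p - a \<bullet> a"
    unfolding z_def a_def by (rule inner_projection_defect[OF X])
  have Xa: "X *v a = p - z" by (simp add: z_def)
  have flip: "X *v a - V *v (transpose V *v (X *v a)) = - (z - V *v y)"
    unfolding Xa y_def by (simp add: matrix_vector_mult_diff_distrib p)
  have defect: "a \<bullet> a - (transpose V *v (X *v a)) \<bullet> (transpose V *v (X *v a)) = z \<bullet> z - y \<bullet> y"
    using inner_projection_defect[OF V, of "X *v a"] inner_projection_defect[OF V, of z]
    unfolding flip y_def inner_minus_left inner_minus_right by (simp add: inner_isometry[OF X])
  \<comment> \<open>\<open>r\<close> is the part of \<open>V V\<^sup>T z\<close> orthogonal to \<open>X\<close>; as \<open>z\<close> is itself orthogonal to \<open>X\<close>, Cauchy-Schwarz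
    gains the factor \<open>1 - c\<close>.\<close>
  define r where "r = V *v y - X *v (transpose X *v (V *v y))"
  have rr: "r \<bullet> r \<le> (1 - c) * (y \<bullet> y)"
    using cos[of y] unfolding r_def inner_projection_defect[OF X] by (simp add: inner_isometry[OF V] algebra_simps)
  have "y \<bullet> y = z \<bullet> r"
  proof -
    have "z \<bullet> (X *v q) = 0" for q
      using inner_transpose_left[of X z q] Xz by simp
    then show ?thesis
      using inner_transpose_left[of V z y] by (simp add: r_def inner_diff_right y_def)
  qed
  then have "(y \<bullet> y)\<^sup>2 \<le> (z \<bullet> z) * (r \<bullet> r)" by (simp add: Cauchy_Schwarz_ineq)
  also have "\<dots> \<le> (z \<bullet> z) * ((1 - c) * (y \<bullet> y))" by (intro mult_left_mono rr) simp
  finally have *: "(y \<bullet> y) * (y \<bullet> y) \<le> ((1 - c) * (z \<bullet> z)) * (y \<bullet> y)"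
    by (simp add: power2_eq_square mult_ac)
  have "y \<bullet> y \<le> (1 - c) * (z \<bullet> z)"
  proof (cases "y = 0")
    case True
    define e :: "real^'k" where "e = axis undefined 1"
    have ee: "e \<bullet> e = 1" by (simp add: e_def inner_axis_axis)
    have "0 \<le> (V *v e) \<bullet> (V *v e) - (transpose X *v (V *v e)) \<bullet> (transpose X *v (V *v e))"
      using inner_projection_defect[OF X, of "V *v e"] inner_ge_zero by metis
    then have "c \<le> 1" using cos[of e] ee inner_isometry[OF V, of e e] by simp
    then show ?thesis using True by simp
  next
    case False
    then have "0 < y \<bullet> y" by simp
    then show ?thesis using mult_right_le_imp_le[OF *] by blast
  qed
  then show ?thesis
    unfolding defect zz[symmetric] by (simp add: algebra_simps)
qed

lemma diag_mult_vector: "diag d *v w = (\<chi> i. d $ i * w $ i)"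
  by (simp add: vec_eq_iff matrix_vector_mult_def diag_def if_distrib[of "\<lambda>x. x * _"] cong: if_cong)

lemma transpose_diag: "transpose (diag d) = diag d"
  by (auto simp: transpose_def diag_def vec_eq_iff)

lemma svd_lower_bound:
  fixes U W :: "real^'k^'k"
  assumes U: "transpose U ** U = mat 1" and W: "W ** transpose W = mat 1"
    and \<sigma>: "\<And>i. c \<le> (\<sigma> $ i)\<^sup>2"
  defines "C \<equiv> U ** diag \<sigma> ** transpose W"
  shows "c * (w \<bullet> w) \<le> (C *v w) \<bullet> (C *v w)"
proof -
  define z where "z = transpose W *v w"
  have "c * (w \<bullet> w) = c * (z \<bullet> z)"
    using inner_isometry[of "transpose W" w w] W by (simp add: z_def)
  also have "\<dots> = (\<Sum>i\<in>UNIV. c * (z $ i)\<^sup>2)"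
    by (simp add: inner_vec_def sum_distrib_left power2_eq_square)
  also have "\<dots> \<le> (\<Sum>i\<in>UNIV. (\<sigma> $ i)\<^sup>2 * (z $ i)\<^sup>2)"
    by (intro sum_mono mult_right_mono \<sigma>) simp
  also have "\<dots> = (diag \<sigma> *v z) \<bullet> (diag \<sigma> *v z)"
    by (simp add: diag_mult_vector inner_vec_def power2_eq_square mult_ac)
  also have "\<dots> = (C *v w) \<bullet> (C *v w)"
    using inner_isometry[OF U, of "diag \<sigma> *v z" "diag \<sigma> *v z"]
    by (simp add: C_def z_def matrix_vector_mul_assoc matrix_mul_assoc)
  finally show ?thesis .
qed

lemma singular_values_from_svd:
  fixes M :: "real^'k^'m"
  assumes "CARD('k) \<le> CARD('m)"
  obtains U \<sigma> W where "compact_svd M U \<sigma> W"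
    "singular_values M = image_mset (\<lambda>i. \<sigma> $ i) (mset_set UNIV)"
proof -
  obtain U0 \<sigma>0 W0 where "compact_svd M U0 \<sigma>0 W0"
    using compact_svd_exists[OF assms] by blast
  then have "\<exists>S U \<sigma> W. compact_svd M U \<sigma> W \<and> S = image_mset (\<lambda>i. \<sigma> $ i) (mset_set UNIV)"
    by blast
  from someI_ex[OF this] show ?thesis
    using that unfolding singular_values_def by blast
qed

text \<open>The singular values of \<open>Y\<^sup>T X\<close> lie in the unit interval because \<open>Y\<^sup>T\<close> does not increase norms, so their
  arc cosines meet the requirements on a list of principal angles.\<close>

lemma principal_angles_svd:
  fixes X Y :: "real^'k^'n"
  assumes X: "transpose X ** X = mat 1" and Y: "transpose Y ** Y = mat 1"
  obtains U \<sigma> W where "compact_svd (transpose Y ** X) U \<sigma> W"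
    "set (principal_angles X Y) \<subseteq> {0..pi/2}"
    "mset (map cos (principal_angles X Y)) = image_mset (\<lambda>i. \<sigma> $ i) (mset_set UNIV)"
proof -
  define C where "C = transpose Y ** X"
  obtain U \<sigma> W where svd: "compact_svd C U \<sigma> W"
    and sv: "singular_values C = image_mset (\<lambda>i. \<sigma> $ i) (mset_set UNIV)"
    using singular_values_from_svd[of C] by auto
  have \<sigma>: "0 \<le> \<sigma> $ i" "\<sigma> $ i \<le> 1" for i
  proof -
    show "0 \<le> \<sigma> $ i" using svd by (simp add: compact_svd_def)
    have U: "transpose U ** U = mat 1" and W: "transpose W ** W = mat 1"
      using svd by (auto simp: compact_svd_def orthogonal_matrix_def)
    have "C ** W = U ** diag \<sigma> ** (transpose W ** W)"
      using svd by (simp add: compact_svd_def matrix_mul_assoc)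
    then have "C *v column i W = \<sigma> $ i *\<^sub>R column i U"
      using diag_mult_column[of i U \<sigma>] column_matrix_mult[of i C W] by (simp add: W)
    then have "(\<sigma> $ i)\<^sup>2 = (C *v column i W) \<bullet> (C *v column i W)"
      using U transpose_mult_eq_iff_columns[of U] by (simp add: power2_eq_square)
    also have "\<dots> \<le> (X *v column i W) \<bullet> (X *v column i W)"
      using inner_projection_defect[OF Y, of "X *v column i W"]
        inner_ge_zero[of "X *v column i W - Y *v (transpose Y *v (X *v column i W))"]
      by (simp add: C_def matrix_vector_mul_assoc)
    also have "\<dots> = 1"
      using W transpose_mult_eq_iff_columns[of W] by (simp add: inner_isometry[OF X])
    finally show "\<sigma> $ i \<le> 1" by (simp add: abs_square_le_1)
  qed
  define \<theta>s where "\<theta>s = sorted_list_of_multiset (image_mset (\<lambda>i. arccos (\<sigma> $ i)) (mset_set UNIV))"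
  have "sorted \<theta>s" by (simp add: \<theta>s_def)
  moreover have "set \<theta>s \<subseteq> {0..pi/2}"
  proof -
    have "0 \<le> arccos (\<sigma> $ i)" "arccos (\<sigma> $ i) \<le> pi / 2" for i
      using \<sigma>[of i] by (intro arccos_lbound arccos_le_pi2; simp)+
    then show ?thesis by (auto simp: \<theta>s_def)
  qed
  moreover have "mset (map cos \<theta>s) = singular_values C"
  proof -
    have "cos (arccos (\<sigma> $ i)) = \<sigma> $ i" for i
      using \<sigma>[of i] by (intro cos_arccos) auto
    then show ?thesis by (simp add: \<theta>s_def sv image_mset.compositionality o_def)
  qed
  ultimately have "\<exists>\<theta>s. sorted \<theta>s \<and> set \<theta>s \<subseteq> {0..pi/2} \<and> mset (map cos \<theta>s) = singular_values C"
    by blast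
  from someI_ex[OF this] show ?thesis
    using that[of U \<sigma> W] svd sv unfolding principal_angles_def C_def by auto
qed

text \<open>The first bound follows from \<open>sin\<^sup>2 \<theta> \<le> \<theta>\<^sup>2\<close>, summed over the
  principal angles; the other two hold because each single angle is at most the distance, and
  \<open>cos\<^sup>2 (\<pi>/4) = 1/2\<close>.\<close>

lemma grassmann_dist_le_quarter_pi:
  fixes X V :: "real^'k^'n"
  assumes X: "transpose X ** X = mat 1" and V: "transpose V ** V = mat 1"
    and dist: "grassmann_dist X V \<le> pi / 4"
  shows "CARD('k) - overlap V X \<le> (pi / 4)\<^sup>2"
    and "1 / 2 * (w \<bullet> w) \<le> (transpose V *v (X *v w)) \<bullet> (transpose V *v (X *v w))"
    and "1 / 2 * (w \<bullet> w) \<le> (transpose X *v (V *v w)) \<bullet> (transpose X *v (V *v w))"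
proof -
  define C where "C = transpose V ** X"
  let ?\<theta>s = "principal_angles X V"
  obtain U \<sigma> W where svd: "compact_svd C U \<sigma> W" and range: "set ?\<theta>s \<subseteq> {0..pi/2}"
    and cos: "mset (map cos ?\<theta>s) = image_mset (\<lambda>i. \<sigma> $ i) (mset_set UNIV)"
    using principal_angles_svd[OF X V] unfolding C_def by metis
  have C: "C = U ** diag \<sigma> ** transpose W" and U: "transpose U ** U = mat 1" "U ** transpose U = mat 1"
    and W: "transpose W ** W = mat 1" "W ** transpose W = mat 1"
    using svd by (auto simp: compact_svd_def orthogonal_matrix_def matrix_left_right_inverse)
  have sq: "(\<Sum>\<theta>\<leftarrow>?\<theta>s. \<theta>\<^sup>2) \<le> (pi / 4)\<^sup>2"
    using dist unfolding grassmann_dist_def by (rule sqrt_le_D)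
  have \<sigma>: "1 / 2 \<le> (\<sigma> $ i)\<^sup>2" for i
  proof -
    have "\<sigma> $ i \<in># mset (map cos ?\<theta>s)" unfolding cos by simp
    then obtain \<theta> where \<theta>: "\<theta> \<in> set ?\<theta>s" "\<sigma> $ i = cos \<theta>" by auto
    have "\<theta>\<^sup>2 \<le> (\<Sum>\<theta>\<leftarrow>?\<theta>s. \<theta>\<^sup>2)"
      using \<theta>(1) by (intro member_le_sum_list) auto
    with sq have "\<theta>\<^sup>2 \<le> (pi / 4)\<^sup>2" by simp
    then have "\<theta> \<le> pi / 4" by (rule power2_le_imp_le) simp
    then have "cos (pi / 4) \<le> cos \<theta>"
      using range \<theta>(1) by (intro cos_monotone_0_pi_le) auto
    then have "(cos (pi / 4))\<^sup>2 \<le> (cos \<theta>)\<^sup>2"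
      by (intro power_mono) (auto simp: cos_45)
    then show ?thesis by (simp add: \<theta>(2) cos_45 power_divide)
  qed
  have "overlap V X = C \<bullet> C" by (simp add: overlap_def C_def)
  also have "\<dots> = diag \<sigma> \<bullet> diag \<sigma>"
  proof -
    have "C \<bullet> C = (U ** diag \<sigma>) \<bullet> (U ** diag \<sigma> ** (transpose W ** W))"
      unfolding C by (simp add: inner_matrix_mult_right matrix_mul_assoc)
    also have "\<dots> = diag \<sigma> \<bullet> (transpose U ** U ** diag \<sigma>)"
      by (simp only: W(1) matrix_mul_rid inner_matrix_mult_left[of U] matrix_mul_assoc)
    finally show ?thesis by (simp add: U(1))
  qed
  also have "\<dots> = (\<Sum>i\<in>UNIV. (\<sigma> $ i)\<^sup>2)"
  proof -
    have "column i (diag \<sigma>) = \<sigma> $ i *\<^sub>R axis i 1" for i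
      by (simp add: vec_eq_iff column_def diag_def axis_def)
    then show ?thesis by (simp add: inner_matrix_columns inner_axis_axis power2_eq_square)
  qed
  finally have "CARD('k) - overlap V X = (\<Sum>i\<in>UNIV. 1 - (\<sigma> $ i)\<^sup>2)"
    by (simp add: sum_subtractf)
  also have "\<dots> = sum_mset (image_mset (\<lambda>x. 1 - x\<^sup>2) (mset (map cos ?\<theta>s)))"
    unfolding cos by (simp add: sum_unfold_sum_mset image_mset.compositionality o_def)
  also have "\<dots> = (\<Sum>\<theta>\<leftarrow>?\<theta>s. 1 - (cos \<theta>)\<^sup>2)"
    by (simp only: o_def sum_mset_sum_list list.map_comp flip: mset_map)
  also have "\<dots> \<le> (\<Sum>\<theta>\<leftarrow>?\<theta>s. \<theta>\<^sup>2)"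
  proof (rule sum_list_mono)
    fix \<theta> :: real
    have "(sin \<theta>)\<^sup>2 \<le> \<theta>\<^sup>2"
      using abs_sin_x_le_abs_x abs_le_square_iff by blast
    then show "1 - (cos \<theta>)\<^sup>2 \<le> \<theta>\<^sup>2" by (simp add: sin_squared_eq)
  qed
  finally show "CARD('k) - overlap V X \<le> (pi / 4)\<^sup>2" using sq by simp
  show "1 / 2 * (w \<bullet> w) \<le> (transpose V *v (X *v w)) \<bullet> (transpose V *v (X *v w))"
    using svd_lower_bound[OF U(1) W(2) \<sigma>, of w] unfolding C[symmetric]
    by (simp add: C_def matrix_vector_mul_assoc)
  have "transpose X ** V = transpose C" by (simp add: C_def matrix_transpose_mul)
  also have "\<dots> = W ** diag \<sigma> ** transpose U"
    by (simp add: C matrix_transpose_mul transpose_diag matrix_mul_assoc)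
  finally show "1 / 2 * (w \<bullet> w) \<le> (transpose X *v (V *v w)) \<bullet> (transpose X *v (V *v w))"
    using svd_lower_bound[OF W(1) U(2) \<sigma>, of w] by (simp add: matrix_vector_mul_assoc)
qed

section \<open>The gradient and its component towards the dominant subspace\<close>

text \<open>Half of the negative Riemannian gradient of the objective.\<close>

definition ascent_dir :: "real^'n^'n \<Rightarrow> real^'k^'n \<Rightarrow> real^'k^'n" where
  "ascent_dir A X = (mat 1 - X ** transpose X) ** A ** X"

lemma ascent_dir_tangent:
  fixes X :: "real^'k^'n"
  assumes X: "transpose X ** X = mat 1"
  shows "transpose X ** ascent_dir A X = 0"
  unfolding ascent_dir_def by (simp add: matrix_diff_rdistrib matrix_diff_ldistrib matrix_mul_assoc X)

lemma inner_ascent_dir_self: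
  fixes X :: "real^'k^'n"
  assumes X: "transpose X ** X = mat 1"
  shows "(A ** X) \<bullet> ascent_dir A X = ascent_dir A X \<bullet> ascent_dir A X"
proof -
  have "ascent_dir A X = A ** X - X ** (transpose X ** A ** X)"
    by (simp add: ascent_dir_def matrix_diff_rdistrib matrix_mul_assoc)
  moreover have "(X ** M) \<bullet> ascent_dir A X = 0" for M
    by (simp only: inner_matrix_mult_left[of X] ascent_dir_tangent[OF X] inner_zero_right)
  ultimately show ?thesis by (metis diff_zero inner_diff_left)
qed

text \<open>Half of the derivative of the overlap with \<open>V\<close> in the direction \<open>ascent_dir A X\<close>.\<close>

definition gap_coupling :: "real^'n^'n \<Rightarrow> real^'k^'n \<Rightarrow> real^'k^'n \<Rightarrow> real" where
  "gap_coupling A V X = (V ** transpose V ** X) \<bullet> ascent_dir A X"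

text \<open>Only the tangential part of \<open>P X\<close> is seen by the gradient, and its squared norm is at
  most the sum of the squared sines.\<close>

lemma gap_coupling_le:
  fixes V X :: "real^'k^'n"
  assumes V: "transpose V ** V = mat 1" and X: "transpose X ** X = mat 1"
  shows "(gap_coupling A V X)\<^sup>2 \<le> (CARD('k) - overlap V X) * (ascent_dir A X \<bullet> ascent_dir A X)"
proof -
  define D where "D = (mat 1 - X ** transpose X) ** (V ** transpose V ** X)"
  have "D = V ** transpose V ** X - X ** (transpose X ** V ** transpose V ** X)"
    by (simp add: D_def matrix_diff_rdistrib matrix_mul_assoc)
  moreover have "(X ** M) \<bullet> ascent_dir A X = 0" for M
    by (simp only: inner_matrix_mult_left[of X] ascent_dir_tangent[OF X] inner_zero_right)
  ultimately have "gap_coupling A V X = D \<bullet> ascent_dir A X"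
    unfolding gap_coupling_def by (metis diff_zero inner_diff_left)
  then have "(gap_coupling A V X)\<^sup>2 \<le> (D \<bullet> D) * (ascent_dir A X \<bullet> ascent_dir A X)"
    by (simp add: Cauchy_Schwarz_ineq)
  also have "\<dots> \<le> (CARD('k) - overlap V X) * (ascent_dir A X \<bullet> ascent_dir A X)"
    using tangential_part_of_projection_le[OF V X] by (intro mult_right_mono) (auto simp: D_def)
  finally show ?thesis .
qed

section \<open>Spectral estimates\<close>

text \<open>The ordered eigenbasis, and an orthonormal basis \<open>V\<close> of the span of the first \<open>k\<close> eigenvectors. \<open>V\<close> need not
  consist of eigenvectors.\<close>

locale eigen_gap =
  fixes A :: "real^'n^'n" and lam :: "nat \<Rightarrow> real" and v :: "nat \<Rightarrow> real^'n" and V :: "real^'k^'n"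
  assumes k_less_n: "CARD('k) < CARD('n)"
    and symmetric: "transpose A = A"
    and sorted: "1 \<le> i \<Longrightarrow> i \<le> j \<Longrightarrow> j \<le> CARD('n) \<Longrightarrow> lam j \<le> lam i"
    and orthonormal: "i \<in> {1..CARD('n)} \<Longrightarrow> j \<in> {1..CARD('n)} \<Longrightarrow> v i \<bullet> v j = (if i = j then 1 else 0)"
    and eigenvectors: "i \<in> {1..CARD('n)} \<Longrightarrow> A *v v i = lam i *\<^sub>R v i"
    and V: "represents V (span (v ` {1..CARD('k)}))"
begin

definition "gap = lam CARD('k) - lam (CARD('k) + 1)"

text \<open>Half of the smoothness constant \<open>\<gamma>\<close> of the objective.\<close>

definition "spread = lam 1 - lam CARD('n)"

definition excess :: "real^'k^'n \<Rightarrow> real" where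
  "excess X = objective A X + (\<Sum>i=1..CARD('k). lam i)"

definition sine_sq :: "real^'k^'n \<Rightarrow> real" where
  "sine_sq X = CARD('k) - overlap V X"

lemma V_isometry: "transpose V ** V = mat 1"
  using V by (simp add: represents_def)

lemma k_ge_1: "1 \<le> CARD('k)"
  by (simp add: Suc_le_eq One_nat_def)

lemma inj_v: "inj_on v {1..CARD('n)}"
  using orthonormal by (intro inj_onI) (metis zero_neq_one)

lemma parseval: "x \<bullet> y = (\<Sum>i=1..CARD('n). (x \<bullet> v i) * (y \<bullet> v i))"
proof -
  let ?B = "v ` {1..CARD('n)}"
  have orth: "pairwise orthogonal ?B" and norm: "\<And>b. b \<in> ?B \<Longrightarrow> norm b = 1"
    using orthonormal by (auto simp: pairwise_def orthogonal_def norm_eq_1)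
  have "0 \<notin> ?B" using norm by force
  then have "independent ?B" using pairwise_orthogonal_independent[OF orth] by blast
  moreover have "card ?B = CARD('n)" using card_image[OF inj_v] by simp
  ultimately have "span ?B = UNIV"
    using card_ge_dim_independent[of ?B UNIV] by (auto simp: dim_UNIV)
  then have "(\<Sum>b\<in>?B. (x \<bullet> b) *\<^sub>R b) = x"
    by (intro orthonormal_basis_expand[OF orth norm]) auto
  then have x: "(\<Sum>i=1..CARD('n). (x \<bullet> v i) *\<^sub>R v i) = x"
    by (simp add: sum.reindex[OF inj_v])
  have "x \<bullet> y = (\<Sum>i=1..CARD('n). (x \<bullet> v i) *\<^sub>R v i) \<bullet> y" by (simp only: x)
  then show ?thesis by (simp add: inner_sum_left) (simp add: inner_commute)
qed

lemma parseval_matrix: "X \<bullet> Y = (\<Sum>i=1..CARD('n). (transpose X *v v i) \<bullet> (transpose Y *v v i))"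
  for X Y :: "real^'j^'n"
proof -
  have "transpose Z *v w = (\<chi> j. column j Z \<bullet> w)" for Z :: "real^'j^'n" and w
    by (simp add: vec_eq_iff matrix_vector_mult_def transpose_def column_def inner_vec_def)
  then have "(\<Sum>i=1..CARD('n). (transpose X *v v i) \<bullet> (transpose Y *v v i))
      = (\<Sum>i=1..CARD('n). \<Sum>j\<in>UNIV. (column j X \<bullet> v i) * (column j Y \<bullet> v i))"
    by (simp add: inner_vec_def[of "vec_lambda _"])
  also have "\<dots> = X \<bullet> Y"
    by (subst sum.swap) (simp only: inner_matrix_columns parseval[symmetric])
  finally show ?thesis by simp
qed

lemma inner_A_expand:
  "X \<bullet> (A ** Y) = (\<Sum>i=1..CARD('n). lam i * ((transpose X *v v i) \<bullet> (transpose Y *v v i)))"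
  for X Y :: "real^'j^'n"
  unfolding parseval_matrix
proof (rule sum.cong[OF refl])
  fix i assume i: "i \<in> {1..CARD('n)}"
  have "transpose (A ** Y) *v v i = transpose Y *v (A *v v i)"
    by (simp add: matrix_transpose_mul symmetric matrix_vector_mul_assoc)
  then show "(transpose X *v v i) \<bullet> (transpose (A ** Y) *v v i) = lam i * ((transpose X *v v i) \<bullet> (transpose Y *v v i))"
    by (simp add: eigenvectors[OF i] matrix_vector_mult_scaleR)
qed

lemma A_bounds:
  shows "lam CARD('n) * (x \<bullet> x) \<le> x \<bullet> (A *v x)" and "x \<bullet> (A *v x) \<le> lam 1 * (x \<bullet> x)"
proof -
  have "(A *v x) \<bullet> v i = lam i * (x \<bullet> v i)" if "i \<in> {1..CARD('n)}" for i
    using inner_transpose_left[of A x "v i"] eigenvectors[OF that] by (simp add: symmetric)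
  then have quad: "x \<bullet> (A *v x) = (\<Sum>i=1..CARD('n). lam i * (x \<bullet> v i)\<^sup>2)"
    unfolding parseval[of x "A *v x"] by (intro sum.cong) (auto simp: power2_eq_square)
  have sq: "c * (x \<bullet> x) = (\<Sum>i=1..CARD('n). c * (x \<bullet> v i)\<^sup>2)" for c
    unfolding parseval[of x x] by (simp add: sum_distrib_left power2_eq_square)
  show "lam CARD('n) * (x \<bullet> x) \<le> x \<bullet> (A *v x)"
    unfolding sq quad by (intro sum_mono mult_right_mono sorted) auto
  show "x \<bullet> (A *v x) \<le> lam 1 * (x \<bullet> x)"
    unfolding sq quad by (intro sum_mono mult_right_mono sorted) auto
qed

lemma transpose_V_mult_v:
  assumes i: "i \<in> {1..CARD('n)}" and "CARD('k) < i"
  shows "transpose V *v v i = 0"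
proof -
  have "column j V \<bullet> v i = 0" for j
  proof -
    have "column j V \<in> span (v ` {1..CARD('k)})"
      using V by (auto simp: represents_def columns_def intro: span_base)
    moreover have "orthogonal (v i) w" if "w \<in> v ` {1..CARD('k)}" for w
      using that assms orthonormal[OF i] k_less_n by (auto simp: orthogonal_def)
    ultimately have "orthogonal (v i) (column j V)" by (rule orthogonal_to_span)
    then show ?thesis by (simp add: orthogonal_def inner_commute)
  qed
  moreover have "(transpose V *v w) $ j = column j V \<bullet> w" for j w
    by (simp add: matrix_vector_mult_def transpose_def column_def inner_vec_def)
  ultimately show ?thesis by (simp add: vec_eq_iff)
qed

lemma projector_v:
  assumes "i \<in> {1..CARD('n)}"
  shows "V *v (transpose V *v v i) = (if i \<le> CARD('k) then v i else 0)"
proof (cases "i \<le> CARD('k)")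
  case True
  then have "v i \<in> span (v ` {1..CARD('k)})"
    using assms by (intro span_base imageI) simp
  moreover have "span (v ` {1..CARD('k)}) = span (columns V)"
    using V by (simp add: represents_def)
  ultimately have "V *v (transpose V *v v i) = v i"
    by (intro projector_fixes_span V_isometry) simp
  then show ?thesis by (simp only: True if_True)
next
  case False
  then have "transpose V *v v i = 0" using assms by (intro transpose_V_mult_v) auto
  then show ?thesis by (simp only: False if_False matrix_vector_mult_0_right)
qed

text \<open>The eigenvalue of the projector \<open>V V\<^sup>T\<close> at the eigenvector \<open>v i\<close>. It lets sums over the dominant indices
  be combined with sums over all indices.\<close>

definition dominant :: "nat \<Rightarrow> real" where "dominant i = (if i \<le> CARD('k) then 1 else 0)"

lemma sum_dominant: "(\<Sum>i=1..CARD('n). g i * dominant i) = (\<Sum>i=1..CARD('k). g i)"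
proof -
  have "(\<Sum>i=1..CARD('n). g i * dominant i) = (\<Sum>i=1..CARD('k). g i * dominant i)"
    using k_less_n by (intro sum.mono_neutral_right) (auto simp: dominant_def)
  then show ?thesis by (simp add: dominant_def)
qed

text \<open>These are the diagonal entries \<open>v\<^sub>i \<bullet> Q v\<^sub>i\<close> and \<open>v\<^sub>i \<bullet> Q P Q v\<^sub>i\<close> for the projectors \<open>Q = X X\<^sup>T\<close> and
  \<open>P = V V\<^sup>T\<close>.\<close>

definition cos_sq :: "real^'k^'n \<Rightarrow> nat \<Rightarrow> real" where
  "cos_sq X i = (transpose X *v v i) \<bullet> (transpose X *v v i)"

definition cos_quad :: "real^'k^'n \<Rightarrow> nat \<Rightarrow> real" where
  "cos_quad X i = (transpose V *v (X *v (transpose X *v v i))) \<bullet> (transpose V *v (X *v (transpose X *v v i)))"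

lemma transpose_projector: "transpose (V ** transpose V ** X) *v v i = transpose X *v (V *v (transpose V *v v i))"
  for X :: "real^'k^'n"
  by (simp add: matrix_transpose_mul matrix_vector_mul_assoc matrix_mul_assoc)

lemma overlap_expand:
  "overlap V X = (\<Sum>i=1..CARD('n). cos_sq X i * dominant i)"
proof -
  have "overlap V X = (\<Sum>i=1..CARD('n). (transpose X *v v i) \<bullet> (transpose (V ** transpose V ** X) *v v i))"
    using parseval_matrix[of X "V ** transpose V ** X"] by (simp add: overlap_eq_inner)
  also have "\<dots> = (\<Sum>i=1..CARD('n). cos_sq X i * dominant i)"
    unfolding transpose_projector
    by (intro sum.cong refl) (simp add: projector_v cos_sq_def dominant_def)
  finally show ?thesis .
qed

context
  fixes X :: "real^'k^'n"
  assumes X: "transpose X ** X = mat 1"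
begin

lemma cos_sq_le_1: "i \<in> {1..CARD('n)} \<Longrightarrow> cos_sq X i \<le> 1"
  using inner_projection_defect[OF X, of "v i"] inner_ge_zero[of "v i - X *v (transpose X *v v i)"]
  by (simp add: cos_sq_def orthonormal)

lemma sum_cos_sq: "(\<Sum>i=1..CARD('n). cos_sq X i) = CARD('k)"
  using parseval_matrix[of X X] by (simp add: cos_sq_def inner_orthonormal_columns[OF X])

lemma sum_dominant_eq_k: "(\<Sum>i=1..CARD('n). dominant i) = CARD('k)"
  using sum_dominant[of "\<lambda>_. 1"] by simp

text \<open>The weights \<open>dominant i - cos_sq X i\<close> sum to zero, so all eigenvalues may be shifted by the same number. The
  shift by \<open>\<lambda>\<^sub>k\<^sub>+\<^sub>1\<close> makes every summand nonnegative.\<close>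

lemma excess_expand:
  "excess X = (\<Sum>i=1..CARD('n). (lam i - lam (CARD('k) + 1)) * (dominant i - cos_sq X i))"
proof -
  have "excess X = (\<Sum>i=1..CARD('n). lam i * dominant i) - (\<Sum>i=1..CARD('n). lam i * cos_sq X i)"
    by (simp add: excess_def objective_eq_inner inner_A_expand sum_dominant cos_sq_def)
  moreover have "(\<Sum>i=1..CARD('n). lam (CARD('k) + 1) * (dominant i - cos_sq X i)) = 0"
    by (simp add: sum_subtractf sum_cos_sq sum_dominant_eq_k flip: sum_distrib_left)
  ultimately show ?thesis by (simp add: left_diff_distrib right_diff_distrib sum_subtractf)
qed

text \<open>The same shift is possible here, because \<open>Q P Q\<close> and \<open>P Q P\<close> have the same trace.\<close>

lemma gap_coupling_expand:
  "gap_coupling A V X = (\<Sum>i=1..CARD('n). (lam i - lam (CARD('k) + 1)) * (cos_sq X i * dominant i - cos_quad X i))"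
proof -
  let ?P = "V ** transpose V"
  have 1: "(?P ** X) \<bullet> (A ** X) = (\<Sum>i=1..CARD('n). lam i * (cos_sq X i * dominant i))"
    unfolding inner_A_expand transpose_projector
    by (intro sum.cong refl) (simp add: projector_v cos_sq_def dominant_def)
  have quad: "(transpose (X ** (transpose X ** (?P ** X))) *v v i) \<bullet> (transpose X *v v i) = cos_quad X i" for i
  proof -
    have "transpose (X ** (transpose X ** (?P ** X))) *v v i
        = transpose X *v (V *v (transpose V *v (X *v (transpose X *v v i))))"
      by (simp add: matrix_transpose_mul matrix_vector_mul_assoc matrix_mul_assoc)
    then show ?thesis by (simp add: cos_quad_def inner_transpose_left inner_commute[of "V *v _"])
  qed
  have "(?P ** X) \<bullet> (X ** (transpose X ** (A ** X))) = (transpose X ** (?P ** X)) \<bullet> (transpose X ** (A ** X))"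
    using inner_matrix_mult_left[of X "transpose X ** (A ** X)" "?P ** X"] by (simp only: inner_commute)
  also have "\<dots> = (X ** (transpose X ** (?P ** X))) \<bullet> (A ** X)"
    by (rule inner_matrix_mult_left[symmetric])
  also have "\<dots> = (\<Sum>i=1..CARD('n). lam i * cos_quad X i)"
    unfolding inner_A_expand quad ..
  finally have 2: "(?P ** X) \<bullet> (X ** (transpose X ** (A ** X))) = (\<Sum>i=1..CARD('n). lam i * cos_quad X i)" .
  have "(\<Sum>i=1..CARD('n). cos_quad X i) = (X ** (transpose X ** (?P ** X))) \<bullet> X"
    unfolding parseval_matrix quad ..
  also have "\<dots> = overlap V X"
  proof -
    have "(X ** (transpose X ** (?P ** X))) \<bullet> X = mat 1 \<bullet> (transpose X ** (?P ** X))"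
      unfolding inner_matrix_mult_left[of X] X by (rule inner_commute)
    also have "\<dots> = X \<bullet> (?P ** X)"
      using inner_matrix_mult_left[of X "mat 1" "?P ** X"] by simp
    finally show ?thesis by (simp only: overlap_eq_inner)
  qed
  finally have 3: "(\<Sum>i=1..CARD('n). lam (CARD('k) + 1) * (cos_sq X i * dominant i - cos_quad X i)) = 0"
    by (simp add: sum_subtractf overlap_expand flip: sum_distrib_left)
  have "ascent_dir A X = A ** X - X ** (transpose X ** (A ** X))"
    by (simp add: ascent_dir_def matrix_diff_rdistrib matrix_mul_assoc)
  then have "gap_coupling A V X = (\<Sum>i=1..CARD('n). lam i * (cos_sq X i * dominant i)) - (\<Sum>i=1..CARD('n). lam i * cos_quad X i)"
    unfolding gap_coupling_def by (simp add: inner_diff_right 1 2)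
  then show ?thesis using 3 by (simp add: left_diff_distrib right_diff_distrib sum_subtractf)
qed

lemma lam_dominant: "i \<in> {1..CARD('n)} \<Longrightarrow> i \<le> CARD('k) \<Longrightarrow> gap \<le> lam i - lam (CARD('k) + 1)"
  using sorted[of i "CARD('k)"] k_less_n by (simp add: gap_def)

lemma gap_nonneg: "0 \<le> gap"
  using sorted[of "CARD('k)" "CARD('k) + 1"] k_less_n k_ge_1 by (simp add: gap_def)

lemma lam_nondominant: "i \<in> {1..CARD('n)} \<Longrightarrow> \<not> i \<le> CARD('k) \<Longrightarrow> lam i - lam (CARD('k) + 1) \<le> 0"
  using sorted[of "CARD('k) + 1" i] by simp

lemma excess_ge_gap: "gap * sine_sq X \<le> excess X"
proof -
  have "gap * sine_sq X = (\<Sum>i=1..CARD('n). gap * ((1 - cos_sq X i) * dominant i))"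
    by (simp add: sine_sq_def overlap_expand left_diff_distrib sum_subtractf sum_dominant_eq_k flip: sum_distrib_left)
  also have "\<dots> \<le> excess X"
    unfolding excess_expand
  proof (rule sum_mono)
    fix i assume i: "i \<in> {1..CARD('n)}"
    have "0 \<le> cos_sq X i" by (simp add: cos_sq_def)
    then show "gap * ((1 - cos_sq X i) * dominant i) \<le> (lam i - lam (CARD('k) + 1)) * (dominant i - cos_sq X i)"
      using lam_dominant[OF i] lam_nondominant[OF i] cos_sq_le_1[OF i]
      by (cases "i \<le> CARD('k)") (auto simp: dominant_def intro: mult_right_mono mult_nonpos_nonpos mult_nonpos_nonneg)
  qed
  finally show ?thesis .
qed

text \<open>With both sides expanded in the eigenbasis and shifted, the inequality holds term by term. For
  \<open>i > k\<close> it is the lower bound on the cosines applied to \<open>X\<^sup>T v\<^sub>i\<close>; for \<open>i \<le> k\<close> it is the bound for the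
  orthogonal complements.\<close>

lemma gap_coupling_ge_excess:
  assumes "\<And>w. c * (w \<bullet> w) \<le> (transpose V *v (X *v w)) \<bullet> (transpose V *v (X *v w))"
    and "\<And>y. c * (y \<bullet> y) \<le> (transpose X *v (V *v y)) \<bullet> (transpose X *v (V *v y))"
  shows "c * excess X \<le> gap_coupling A V X"
  unfolding excess_expand gap_coupling_expand sum_distrib_left
proof (rule sum_mono)
  fix i assume i: "i \<in> {1..CARD('n)}"
  let ?l = "lam i - lam (CARD('k) + 1)"
  show "c * (?l * (dominant i - cos_sq X i)) \<le> ?l * (cos_sq X i * dominant i - cos_quad X i)"
  proof (cases "i \<le> CARD('k)")
    case True
    have "c * (1 - cos_sq X i) \<le> cos_sq X i - cos_quad X i"
      using complementary_cosine_bound[OF V_isometry X assms(2), of "v i"] projector_v[OF i] True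
      by (simp add: cos_sq_def cos_quad_def orthonormal[OF i i])
    moreover have "0 \<le> ?l" using lam_dominant[OF i True] gap_nonneg by simp
    ultimately have "?l * (c * (1 - cos_sq X i)) \<le> ?l * (cos_sq X i - cos_quad X i)"
      by (rule mult_left_mono)
    then show ?thesis using True by (simp add: dominant_def mult_ac)
  next
    case False
    have "c * cos_sq X i \<le> cos_quad X i"
      using assms(1) by (simp add: cos_sq_def cos_quad_def)
    then have "?l * cos_quad X i \<le> ?l * (c * cos_sq X i)"
      using lam_nondominant[OF i False] by (rule mult_left_mono_neg)
    then show ?thesis using False by (simp add: dominant_def mult_ac)
  qed
qed

lemma sine_sq_nonneg: "0 \<le> sine_sq X"
  using tangential_part_of_projection_le[OF V_isometry X] inner_ge_zero order_trans
  unfolding sine_sq_def by blast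

lemma excess_nonneg: "0 \<le> excess X"
  using excess_ge_gap mult_nonneg_nonneg[OF gap_nonneg sine_sq_nonneg] by linarith

text \<open>A Polyak-Lojasiewicz inequality: combine \<open>c F \<le> B\<close>, \<open>B\<^sup>2 \<le> s |Z|\<^sup>2\<close> and \<open>gap \<cdot> s \<le> F\<close>, and
  cancel one factor \<open>F\<close>.\<close>

lemma gradient_domination:
  assumes "0 \<le> c"
    and cos: "\<And>w. c * (w \<bullet> w) \<le> (transpose V *v (X *v w)) \<bullet> (transpose V *v (X *v w))"
      "\<And>y. c * (y \<bullet> y) \<le> (transpose X *v (V *v y)) \<bullet> (transpose X *v (V *v y))"
  shows "c\<^sup>2 * gap * excess X \<le> ascent_dir A X \<bullet> ascent_dir A X"
proof (cases "excess X = 0")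
  case False
  then have pos: "0 < excess X" using excess_nonneg by simp
  let ?Z = "ascent_dir A X \<bullet> ascent_dir A X"
  have "(c * excess X)\<^sup>2 \<le> (gap_coupling A V X)\<^sup>2"
    using gap_coupling_ge_excess[OF cos] assms(1) excess_nonneg by (intro power_mono) auto
  also have "\<dots> \<le> sine_sq X * ?Z"
    using gap_coupling_le[OF V_isometry X] by (simp add: sine_sq_def)
  finally have "gap * (c * excess X)\<^sup>2 \<le> gap * (sine_sq X * ?Z)"
    by (intro mult_left_mono gap_nonneg)
  also have "\<dots> \<le> excess X * ?Z"
    using mult_right_mono[OF excess_ge_gap inner_ge_zero[of "ascent_dir A X"]] by (simp add: mult_ac)
  finally have "(c\<^sup>2 * gap * excess X) * excess X \<le> ?Z * excess X"
    by (simp add: power2_eq_square mult_ac)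
  then show ?thesis using pos by (rule mult_right_le_imp_le)
qed simp

section \<open>One step of steepest descent\<close>

context
  fixes X' ::"real^'k^'n"
  assumes spread: "0 < spread"
    and X': "represents X' (grassmann_exp X ((1 / spread) *\<^sub>R ascent_dir A X))"
begin

text \<open>The second-order bound with \<open>H = A\<close>.\<close>

lemma step_decreases_excess:
  "excess X' \<le> excess X - (ascent_dir A X \<bullet> ascent_dir A X) / spread"
proof -
  let ?Z = "ascent_dir A X"
  let ?G = "(1 / spread) *\<^sub>R ?Z"
  have "transpose X ** ?G = 0"
    by (simp add: matrix_mult_scaleR ascent_dir_tangent[OF X])
  then have "X \<bullet> (A ** X) + 2 * (X \<bullet> (A ** ?G)) - spread * (?G \<bullet> ?G) \<le> X' \<bullet> (A ** X')"
    unfolding spread_def[symmetric]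
    using grassmann_exp_second_order_bound[OF _ X _ X' symmetric A_bounds] k_less_n by (simp add: spread_def)
  moreover have "X \<bullet> (A ** ?G) = (?Z \<bullet> ?Z) / spread"
    using inner_matrix_mult_left[of A X ?G] inner_ascent_dir_self[OF X, of A] by (simp add: symmetric)
  moreover have "spread * (?G \<bullet> ?G) = (?Z \<bullet> ?Z) / spread"
    using spread by simp
  ultimately show ?thesis by (simp add: excess_def objective_eq_inner)
qed

text \<open>The second-order bound with \<open>H = V V\<^sup>T\<close>, whose spectrum lies in the unit interval.\<close>

lemma step_sine_sq:
  "sine_sq X' \<le> sine_sq X - 2 * gap_coupling A V X / spread + (ascent_dir A X \<bullet> ascent_dir A X) / spread\<^sup>2"
proof -
  let ?P = "V ** transpose V"
  let ?G = "(1 / spread) *\<^sub>R ascent_dir A X"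
  have tangent: "transpose X ** ?G = 0"
    by (simp add: matrix_mult_scaleR ascent_dir_tangent[OF X])
  have P: "transpose ?P = ?P" by (simp add: matrix_transpose_mul)
  have quad: "x \<bullet> (?P *v x) = (transpose V *v x) \<bullet> (transpose V *v x)" for x
    by (simp add: inner_transpose_left matrix_vector_mul_assoc)
  have lower: "0 * (x \<bullet> x) \<le> x \<bullet> (?P *v x)" for x
    by (simp add: quad)
  have upper: "x \<bullet> (?P *v x) \<le> 1 * (x \<bullet> x)" for x
    using inner_projection_defect[OF V_isometry, of x] inner_ge_zero[of "x - V *v (transpose V *v x)"]
    unfolding quad by simp
  have "X \<bullet> (?P ** X) + 2 * (X \<bullet> (?P ** ?G)) - (1 - 0) * (?G \<bullet> ?G) \<le> X' \<bullet> (?P ** X')"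
    using grassmann_exp_second_order_bound[OF _ X tangent X' P lower upper] k_less_n by simp
  moreover have "X \<bullet> (?P ** ?G) = gap_coupling A V X / spread"
    using inner_matrix_mult_left[of ?P X ?G] unfolding P by (simp add: gap_coupling_def)
  moreover have "?G \<bullet> ?G = (ascent_dir A X \<bullet> ascent_dir A X) / spread\<^sup>2"
    by (simp add: power2_eq_square)
  ultimately show ?thesis by (simp add: overlap_eq_inner sine_sq_def power2_eq_square)
qed

text \<open>The quadratic error term in the recursion for the sines is paid for by the decrease of the excess. For
  \<open>c \<ge> 0\<close> the potential \<open>sine_sq + excess / spread\<close> does not increase, and \<open>c = 1/2\<close> even removes the
  excess from the right-hand side.\<close>

lemma step_potential:
  assumes cos: "\<And>w. c * (w \<bullet> w) \<le> (transpose V *v (X *v w)) \<bullet> (transpose V *v (X *v w))"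
      "\<And>y. c * (y \<bullet> y) \<le> (transpose X *v (V *v y)) \<bullet> (transpose X *v (V *v y))"
  shows "sine_sq X' + excess X' / spread \<le> sine_sq X + (1 - 2 * c) * (excess X / spread)"
proof -
  let ?z = "ascent_dir A X \<bullet> ascent_dir A X"
  have "?z / spread \<le> excess X - excess X'"
    using step_decreases_excess by simp
  then have "?z / spread / spread \<le> (excess X - excess X') / spread"
    using spread by (intro divide_right_mono) auto
  then have "?z / spread\<^sup>2 \<le> excess X / spread - excess X' / spread"
    by (simp add: power2_eq_square diff_divide_distrib)
  moreover have "2 * (c * (excess X / spread)) \<le> 2 * gap_coupling A V X / spread"
    using gap_coupling_ge_excess[OF cos] spread by (simp add: divide_right_mono)
  ultimately show ?thesis
    using step_sine_sq by (simp add: left_diff_distrib diff_divide_distrib mult.assoc)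
qed

lemma step_contracts_excess:
  assumes "0 \<le> c"
    and cos: "\<And>w. c * (w \<bullet> w) \<le> (transpose V *v (X *v w)) \<bullet> (transpose V *v (X *v w))"
      "\<And>y. c * (y \<bullet> y) \<le> (transpose X *v (V *v y)) \<bullet> (transpose X *v (V *v y))"
  shows "excess X' \<le> (1 - c\<^sup>2 * (gap / spread)) * excess X"
proof -
  have "c\<^sup>2 * gap * excess X / spread \<le> (ascent_dir A X \<bullet> ascent_dir A X) / spread"
    using gradient_domination[OF assms] spread by (intro divide_right_mono) auto
  then show ?thesis using step_decreases_excess by (simp add: left_diff_distrib)
qed

end

end

end

section \<open>Linear convergence\<close>

theorem proposition22:
  fixes A :: "real^'n^'n"
    and lam :: "nat \<Rightarrow> real" and v :: "nat \<Rightarrow> real^'n"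
    and k n :: nat and \<delta> \<gamma> fstar c\<^sub>Q :: real
    and \<V> :: "(real^'n) set" and V :: "real^'k^'n"
    and \<X> :: "nat \<Rightarrow> (real^'n) set" and X :: "nat \<Rightarrow> real^'k^'n"
  assumes dims: "n = CARD('n)" "k = CARD('k)" "1 \<le> k" "k \<le> n - 1"
    and symmetric: "transpose A = A"
    and psd: "\<And>x. 0 \<le> x \<bullet> (A *v x)"
    and eigenvalues_sorted: "\<And>i j. 1 \<le> i \<Longrightarrow> i \<le> j \<Longrightarrow> j \<le> n \<Longrightarrow> lam j \<le> lam i"
    and orthonormal: "\<And>i j. i \<in> {1..n} \<Longrightarrow> j \<in> {1..n} \<Longrightarrow> v i \<bullet> v j = (if i = j then 1 else 0)"
    and eigenvectors: "\<And>i. i \<in> {1..n} \<Longrightarrow> A *v v i = lam i *\<^sub>R v i"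
    and \<delta>: "\<delta> = lam k - lam (k + 1)"
    and \<gamma>: "\<gamma> = 2 * (lam 1 - lam n)"
    and fstar: "fstar = - (\<Sum>i=1..k. lam i)"
    and c\<^sub>Q: "c\<^sub>Q = 4 / pi\<^sup>2"
    and \<V>: "\<V> = span (v ` {1..k})" "represents V \<V>"
    and gap: "\<delta> > 0"
    and start: "\<X> 0 \<in> Gr k" "grassmann_dist (X 0) V \<le> pi / 4"
    and representatives: "\<And>t. represents (X t) (\<X> t)"
    and descent: "\<And>t. \<X> (Suc t) = grassmann_exp (X t) (- (1 / \<gamma>) *\<^sub>R riem_grad A (X t))"
  shows "\<forall>t. objective A (X t) - fstar
           \<le> (1 - 0.32 * c\<^sub>Q * (\<delta> / \<gamma>)) ^ t * (objective A (X 0) - fstar)"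
proof -
  have k_less_n: "CARD('k) < CARD('n)"
    using dims by simp
  interpret eigen_gap A lam v V
  proof
    show "CARD('k) < CARD('n)" by (rule k_less_n)
    show "transpose A = A" by (rule symmetric)
    show "represents V (span (v ` {1..CARD('k)}))"
      using \<V> dims(2) by simp
  qed (use eigenvalues_sorted orthonormal eigenvectors dims(1) in auto)
  have gap_eq: "\<delta> = gap"
    unfolding \<delta> gap_def dims(2) ..
  have spread_eq: "\<gamma> = 2 * spread"
    unfolding \<gamma> spread_def dims(1) ..
  have excess_eq: "objective A Y - fstar = excess Y" for Y :: "real^'k^'n"
    by (simp add: excess_def fstar dims(2))
  have "gap \<le> spread"
    using sorted[of 1 "CARD('k)"] sorted[of "CARD('k) + 1" "CARD('n)"] k_less_n k_ge_1
    by (simp add: gap_def spread_def)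
  with gap gap_eq have spread_pos: "0 < spread" and ratio: "0 \<le> gap / spread" "gap / spread \<le> 1"
    by simp_all
  have X: "transpose (X t) ** X t = mat 1" for t
    using representatives by (simp add: represents_def)
  have "- (1 / \<gamma>) *\<^sub>R riem_grad A (X t) = (1 / spread) *\<^sub>R ascent_dir A (X t)" for t
    by (simp add: riem_grad_def ascent_dir_def spread_eq)
  then have X': "represents (X (Suc t)) (grassmann_exp (X t) ((1 / spread) *\<^sub>R ascent_dir A (X t)))" for t
    using representatives[of "Suc t"] unfolding descent by simp
  note start_bounds = grassmann_dist_le_quarter_pi[OF X V_isometry start(2)]
  have "(pi / 4)\<^sup>2 \<le> (0.8)\<^sup>2"
    using pi_approx(2) by (intro power_mono) simp_all
  then have start_sine: "sine_sq (X 0) \<le> 0.64"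
    using start_bounds(1) by (simp add: sine_sq_def power2_eq_square)
  have cosines: "0.36 * (w \<bullet> w) \<le> (transpose V *v (X t *v w)) \<bullet> (transpose V *v (X t *v w))"
      "0.36 * (w \<bullet> w) \<le> (transpose (X t) *v (V *v w)) \<bullet> (transpose (X t) *v (V *v w))"
    if "sine_sq (X t) \<le> 0.64" for t w
  proof -
    have "0.36 * (w \<bullet> w) \<le> (1 - (CARD('k) - overlap V (X t))) * (w \<bullet> w)"
      using that by (intro mult_right_mono) (auto simp: sine_sq_def)
    then show "0.36 * (w \<bullet> w) \<le> (transpose V *v (X t *v w)) \<bullet> (transpose V *v (X t *v w))"
        "0.36 * (w \<bullet> w) \<le> (transpose (X t) *v (V *v w)) \<bullet> (transpose (X t) *v (V *v w))"
      using overlap_controls_smallest_cosine[OF V_isometry X, of t w]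
        overlap_controls_smallest_cosine[OF X V_isometry, of t w]
      unfolding overlap_commute[of "X t" V] by linarith+
  qed
  \<comment> \<open>The initial excess could be as large as \<open>spread\<close> times the initial sines; the cosine bound \<open>1/2\<close>, available in
    the first step, prevents it from entering the potential.\<close>
  have potential: "sine_sq (X (Suc t)) + excess (X (Suc t)) / spread \<le> 0.64" for t
  proof (induction t)
    case 0
    have "sine_sq (X (Suc 0)) + excess (X (Suc 0)) / spread \<le> sine_sq (X 0)"
      using step_potential[OF X spread_pos X' start_bounds(2,3)] by simp
    then show ?case using start_sine by linarith
  next
    case (Suc t)
    have nonneg: "0 \<le> excess (X (Suc t)) / spread"
      using excess_nonneg[OF X] spread_pos by simp
    with Suc have "sine_sq (X (Suc t)) \<le> 0.64" by linarith
    note step_potential[OF X spread_pos X' cosines[OF this]]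
    moreover have "(1 - 2 * 0.36) * (excess (X (Suc t)) / spread) \<le> 1 * (excess (X (Suc t)) / spread)"
      by (intro mult_right_mono nonneg) simp
    ultimately show ?case using Suc by linarith
  qed
  have sine: "sine_sq (X t) \<le> 0.64" for t
  proof (cases t)
    case (Suc s)
    have "0 \<le> excess (X t) / spread"
      using excess_nonneg[OF X] spread_pos by simp
    with potential[of s] show ?thesis unfolding Suc by linarith
  qed (use start_sine in simp)
  let ?q = "1 - 0.32 * c\<^sub>Q * (\<delta> / \<gamma>)"
  have "(3::real)\<^sup>2 \<le> pi\<^sup>2"
    using pi_approx(1) by (intro power_mono) simp_all
  then have "0.16 * c\<^sub>Q \<le> (0.36)\<^sup>2" "0.16 * c\<^sub>Q \<le> 1"
    by (simp_all add: c\<^sub>Q field_simps)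
  then have q: "1 - (0.36)\<^sup>2 * (gap / spread) \<le> ?q" "0 \<le> ?q"
    using ratio mult_right_mono[of "0.16 * c\<^sub>Q" "(0.36)\<^sup>2" "gap / spread"]
      mult_mono[of "0.16 * c\<^sub>Q" 1 "gap / spread" 1]
    by (simp_all add: gap_eq spread_eq)
  have step: "excess (X (Suc t)) \<le> ?q * excess (X t)" for t
  proof -
    have "excess (X (Suc t)) \<le> (1 - (0.36)\<^sup>2 * (gap / spread)) * excess (X t)"
      by (rule step_contracts_excess[OF X spread_pos X' _ cosines[OF sine]]) simp
    also have "\<dots> \<le> ?q * excess (X t)"
      by (intro mult_right_mono q excess_nonneg X)
    finally show ?thesis .
  qed
  have "excess (X t) \<le> ?q ^ t * excess (X 0)" for t
  proof (induction t)
    case (Suc t)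
    have "excess (X (Suc t)) \<le> ?q * (?q ^ t * excess (X 0))"
      using step[of t] mult_left_mono[OF Suc q(2)] by linarith
    then show ?case by (simp add: mult_ac)
  qed simp
  then show ?thesis unfolding excess_eq by blast
qed

end
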